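(* Let $\zeta^1<\zeta^2<\zeta^3$ be real constants. There are a constant $C>0$ depending only on $\zeta^1,\zeta^2,\zeta^3$ and an absolute constant $c_0\in(0,1)$ for which the following holds. Let $T>0$ be arbitrary, and let $f(\alpha,t)>g(\alpha,t)$, $\alpha\in\mathbb{R}$, $t\in[0,T)$, be smooth free boundaries solving the three-density (multi-phase) Muskat system $$f_t(\alpha,t)=\int_{\mathbb{R}}\big(\zeta^{21}K(f,f)+\zeta^{32}K(f,g)\big)(\alpha,\beta)\,d\beta,$$ $$g_t(\alpha,t)=\int_{\mathbb{R}}\big(\zeta^{32}K(g,g)+\zeta^{21}K(g,f)\big)(\alpha,\beta)\,d\beta,$$ where $\zeta^{21}=(\zeta^2-\zeta^1)/(2\pi)$, $\zeta^{32}=(\zeta^3-\zeta^2)/(2\pi)$, and where $$\lim_{\alpha\to\infty}f(\alpha,t)=f_\infty>g_\infty=\lim_{\alpha\to\infty}g(\alpha,t).$$ Define $$S(t)=\min_{\alpha\in\mathbb{R}}\big(f(\alpha,t)-g(\alpha,t)\big)$$ and suppose that $0<S(t)\ll\min\{f_\infty-g_\infty,1\}$, in the sense that $0<S(t)\le c_0\min\{f_\infty-g_\infty,1\}$ for $t\in[0,T)$. Then, for all $t\in[0,T)$, $$S(t)\ \ge\ \exp\left(\ln(S(0))\,\exp\left(\int_0^t C(f,g)(s)\,ds\right)\right),$$ where $$C(f,g)(s)=C\,\big(\|f''(\cdot,s)\|_{L^\infty}+\|g''(\cdot,s)\|_{L^\infty}\big)\big(\|f(\cdot,s)\|_{L^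\infty}+\|g(\cdot,s)\|_{L^\infty}+1\big).$$
   Context: Primes denote derivatives in $\alpha$, and the subscript $t$ denotes the time derivative; the time dependence is suppressed inside the integrals. The kernel is $$K(f,g)(\alpha,\beta)=\frac{\beta\,\big(f'(\alpha)-g'(\alpha-\beta)\big)}{\beta^2+\big(f(\alpha)-g(\alpha-\beta)\big)^2},$$ and $K(f,f)$, $K(g,g)$, $K(g,f)$ are obtained by the corresponding substitutions. Integrals are understood as principal values where necessary (including at infinity). The system describes three fluids in a planar porous medium with constant densities $\zeta^1$ in $\{x_2>f(x_1,t)\}$, $\zeta^2$ in $\{f(x_1,t)>x_2>g(x_1,t)\}$ and $\zeta^3$ in $\{x_2<g(x_1,t)\}$ (the stable configuration). The limits $f_\infty$, $g_\infty$ are constants independent of $t$. The definition of $S(t)$ as a minimum includes that the minimum is attained. Norms $\|\cdot\|_{L^\infty}$ are over $\alpha\in\mathbb{R}$. *)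

theory Defs
  imports "HOL-Analysis.Analysis" "HOL-Probability.Essential_Supremum"
begin

text \<open>
  A free boundary is a function \<open>f :: real \<Rightarrow> real \<Rightarrow> real\<close>, written \<open>f \<alpha> t\<close>.
\<close>

definition muskat_kernel :: "(real \<Rightarrow> real) \<Rightarrow> (real \<Rightarrow> real) \<Rightarrow> real \<Rightarrow> real \<Rightarrow> real" where
  "muskat_kernel f g \<alpha> \<beta> =
     \<beta> * (deriv f \<alpha> - deriv g (\<alpha> - \<beta>)) / (\<beta>\<^sup>2 + (f \<alpha> - g (\<alpha> - \<beta>))\<^sup>2)"

text \<open>
  Principal value at \<open>0\<close> and at infinity. The truncation parameters at \<open>0\<close> and at infinity
  are independent of each other; each truncation is symmetric.
\<close>

definition has_pv_integral :: "(real \<Rightarrow> real) \<Rightarrow> real \<Rightarrow> bool" where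
  "has_pv_integral h I \<longleftrightarrow>
     (\<forall>\<epsilon> R. 0 < \<epsilon> \<longrightarrow> \<epsilon> < R \<longrightarrow> set_integrable lborel {\<beta>. \<epsilon> < \<bar>\<beta>\<bar> \<and> \<bar>\<beta>\<bar> < R} h) \<and>
     ((\<lambda>(\<epsilon>, R). set_lebesgue_integral lborel {\<beta>. \<epsilon> < \<bar>\<beta>\<bar> \<and> \<bar>\<beta>\<bar> < R} h) \<longlongrightarrow> I)
       (at_right 0 \<times>\<^sub>F at_top)"

text \<open>
  Joint smoothness on \<open>\<real> \<times> [0,T)\<close>: \<open>F j k\<close> is the partial derivative of \<open>f\<close> of order \<open>j\<close>
  in \<open>\<alpha>\<close> and \<open>k\<close> in \<open>t\<close>; at \<open>t = 0\<close> the time derivatives are one-sided.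
\<close>

definition smooth_on_strip :: "real \<Rightarrow> (real \<Rightarrow> real \<Rightarrow> real) \<Rightarrow> bool" where
  "smooth_on_strip T f \<longleftrightarrow>
     (\<exists>F :: nat \<Rightarrow> nat \<Rightarrow> real \<Rightarrow> real \<Rightarrow> real.
        (\<forall>\<alpha>. \<forall>t\<in>{0..<T}. F 0 0 \<alpha> t = f \<alpha> t) \<and>
        (\<forall>j k. continuous_on (UNIV \<times> {0..<T}) (\<lambda>(\<alpha>, t). F j k \<alpha> t)) \<and>
        (\<forall>j k \<alpha>. \<forall>t\<in>{0..<T}.
           ((\<lambda>x. F j k x t) has_real_derivative F (Suc j) k \<alpha> t) (at \<alpha>) \<and>
           (F j k \<alpha> has_real_derivative F j (Suc k) \<alpha> t) (at t within {0..<T})))"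

text \<open>
  A smooth free boundary is moreover required to have \<open>f\<close> and its second
  derivative in \<open>\<alpha>\<close> bounded on \<open>\<real> \<times> [0,\<tau>]\<close> for every \<open>\<tau> < T\<close> (no uniformity as
  \<open>\<tau> \<rightarrow> T\<close>). Smoothness on the non-compact strip alone does not make the sup norms in
  \<open>muskat_rate\<close> below finite, nor their time integral.
\<close>

definition smooth_free_boundary :: "real \<Rightarrow> (real \<Rightarrow> real \<Rightarrow> real) \<Rightarrow> bool" where
  "smooth_free_boundary T f \<longleftrightarrow>
     smooth_on_strip T f \<and>
     (\<forall>\<tau>\<in>{0..<T}. \<exists>M. \<forall>\<alpha>. \<forall>t\<in>{0..\<tau>}.
        \<bar>f \<alpha> t\<bar> \<le> M \<and> \<bar>(deriv ^^ 2) (\<lambda>x. f x t) \<alpha>\<bar> \<le> M)"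

text \<open>
  The time derivative on the left of each equation is the derivative within \<open>[0,T)\<close>; the
  principal value is taken of the whole integrand.
\<close>

definition muskat_solution ::
  "real \<Rightarrow> real \<Rightarrow> real \<Rightarrow> real \<Rightarrow> (real \<Rightarrow> real \<Rightarrow> real) \<Rightarrow> (real \<Rightarrow> real \<Rightarrow> real) \<Rightarrow> bool" where
  "muskat_solution \<zeta>1 \<zeta>2 \<zeta>3 T f g \<longleftrightarrow>
     (let \<zeta>21 = (\<zeta>2 - \<zeta>1) / (2 * pi); \<zeta>32 = (\<zeta>3 - \<zeta>2) / (2 * pi) in
      \<forall>\<alpha>. \<forall>t\<in>{0..<T}.
        (\<exists>f\<^sub>t. (f \<alpha> has_real_derivative f\<^sub>t) (at t within {0..<T}) \<and>
              has_pv_integral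
                (\<lambda>\<beta>. \<zeta>21 * muskat_kernel (\<lambda>x. f x t) (\<lambda>x. f x t) \<alpha> \<beta>
                   + \<zeta>32 * muskat_kernel (\<lambda>x. f x t) (\<lambda>x. g x t) \<alpha> \<beta>) f\<^sub>t) \<and>
        (\<exists>g\<^sub>t. (g \<alpha> has_real_derivative g\<^sub>t) (at t within {0..<T}) \<and>
              has_pv_integral
                (\<lambda>\<beta>. \<zeta>32 * muskat_kernel (\<lambda>x. g x t) (\<lambda>x. g x t) \<alpha> \<beta>
                   + \<zeta>21 * muskat_kernel (\<lambda>x. g x t) (\<lambda>x. f x t) \<alpha> \<beta>) g\<^sub>t))"

definition Linf_norm :: "(real \<Rightarrow> real) \<Rightarrow> real" where
  "Linf_norm h = real_of_ereal (esssup lborel (\<lambda>\<alpha>. ereal \<bar>h \<alpha>\<bar>))"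

definition muskat_rate ::
  "real \<Rightarrow> (real \<Rightarrow> real \<Rightarrow> real) \<Rightarrow> (real \<Rightarrow> real \<Rightarrow> real) \<Rightarrow> real \<Rightarrow> real" where
  "muskat_rate C f g s =
     C * (Linf_norm ((deriv ^^ 2) (\<lambda>x. f x s)) + Linf_norm ((deriv ^^ 2) (\<lambda>x. g x s)))
       * (Linf_norm (\<lambda>x. f x s) + Linf_norm (\<lambda>x. g x s) + 1)"

definition is_minimum_of :: "real \<Rightarrow> (real \<Rightarrow> real) \<Rightarrow> bool" where
  "is_minimum_of m h \<longleftrightarrow> (\<exists>\<alpha>. h \<alpha> = m) \<and> (\<forall>\<alpha>. m \<le> h \<alpha>)"

end

theory Submission
  imports Defs
begin

text \<open>
  Write \<open>u = f - g\<close>. At a minimum point of \<open>u\<close> the slopes of \<open>f\<close> and \<open>g\<close> agree, so that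
  \<open>f\<^sub>t - g\<^sub>t\<close> is an integral of differences of kernels with the same numerator
  \<open>\<beta> (f'(\<alpha>) - f'(\<alpha> - \<beta>)) = O(\<parallel>f''\<parallel> \<beta>\<^sup>2)\<close> (or the same with \<open>g\<close>) whose denominators come from
  heights that differ by \<open>S\<close>. The integrand is therefore
  \<open>O(\<parallel>f''\<parallel> + \<parallel>g''\<parallel>)\<close> times the minimum of \<open>1\<close>, \<open>S / \<bar>\<beta>\<bar>\<close> and \<open>(\<parallel>f\<parallel> + \<parallel>g\<parallel>) S / \<beta>\<^sup>2\<close>, and
  integration gives \<open>\<bar>f\<^sub>t - g\<^sub>t\<bar> \<le> C(f,g) S \<bar>ln S\<bar>\<close>. Comparing \<open>S(s)\<close> with \<open>u\<close> at the minimum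
  point of a later time bounds the left derivative of \<open>ln (- ln S)\<close> by the rate, which is lower
  semicontinuous in time, and this integrates because \<open>S\<close> cannot jump downwards: at arbitrary points
  \<open>u\<^sup>2 \<bar>u\<^sub>t\<bar>\<close> is bounded on compact time intervals.
\<close>


section \<open>Truncated integrals over symmetric annuli and principal values\<close>

text \<open>The far part \<open>p\<close> is integrated exactly through \<open>P\<close> and not in
  absolute value, because a kernel that decays only like \<open>1 / \<beta>\<close> survives at
  infinity by cancellation between the two sides. The remainder is dominated on three ranges by a
  constant, a multiple of \<open>1 / \<bar>\<beta>\<bar>\<close> and a multiple of
  \<open>1 / \<beta>\<^sup>2\<close>. The bound does not depend on
  \<open>\<epsilon>\<close>.\<close>

lemma annulus_integral_bound:
  fixes h P p :: "real \<Rightarrow> real"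
  assumes ann: "0 < \<epsilon>" "\<epsilon> < 1" "0 < s" "s \<le> 1" "1 < R"
    and int: "set_integrable lborel {\<beta>. \<epsilon> < \<bar>\<beta>\<bar> \<and> \<bar>\<beta>\<bar> < R} h"
    and P: "\<And>\<beta>. 1 \<le> \<bar>\<beta>\<bar> \<Longrightarrow> (P has_real_derivative p \<beta>) (at \<beta>)"
      "\<And>\<beta>. 1 \<le> \<bar>\<beta>\<bar> \<Longrightarrow> isCont p \<beta>"
    and nonneg: "0 \<le> a" "0 \<le> b" "0 \<le> c"
    and near: "\<And>\<beta>. 0 < \<bar>\<beta>\<bar> \<Longrightarrow> \<bar>\<beta>\<bar> < 1 \<Longrightarrow> \<bar>\<beta>\<bar> \<le> s \<Longrightarrow> \<bar>h \<beta>\<bar> \<le> a"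
    and mid: "\<And>\<beta>. s < \<bar>\<beta>\<bar> \<Longrightarrow> \<bar>\<beta>\<bar> < 1 \<Longrightarrow> \<bar>h \<beta>\<bar> \<le> b / \<bar>\<beta>\<bar>"
    and far: "\<And>\<beta>. 1 \<le> \<bar>\<beta>\<bar> \<Longrightarrow> \<bar>h \<beta> - p \<beta>\<bar> \<le> c / \<beta>\<^sup>2"
  shows "\<bar>set_lebesgue_integral lborel {\<beta>. \<epsilon> < \<bar>\<beta>\<bar> \<and> \<bar>\<beta>\<bar> < R} h\<bar>
    \<le> 2 * a * s + 2 * b * (- ln s) + 2 * c + \<bar>P R - P 1 + P (-1) - P (- R)\<bar>"
proof -
  define A where "A = {\<beta>. \<epsilon> < \<bar>\<beta>\<bar> \<and> \<bar>\<beta>\<bar> < R}"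
  define X where "X \<beta> = indicator A \<beta> *\<^sub>R h \<beta>" for \<beta>
  define H where "H \<beta> = p \<beta> * indicator {1..R} \<beta> + p \<beta> * indicator {-R..-1} \<beta>" for \<beta>
  \<comment> \<open>The closed intervals overlap only at endpoints, where the extra terms are
    nonnegative. The three integrals are \<open>2 * s\<close>, \<open>- 2 * ln s\<close> and
    \<open>2 - 2 / R\<close>.\<close>
  define G where "G \<beta> = a * (1 * indicator {-s..s} \<beta>)
    + b * ((1 / \<beta>) * indicator {s..1} \<beta> + (- 1 / \<beta>) * indicator {-1..-s} \<beta>)
    + c * ((1 / \<beta>\<^sup>2) * indicator {1..R} \<beta> + (1 / \<beta>\<^sup>2) * indicator {-R..-1} \<beta>)" for \<beta>
  have H: "has_bochner_integral lborel H ((P R - P 1) + (P (-1) - P (- R)))"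
    unfolding H_def using ann
    by (intro has_bochner_integral_add has_bochner_integral_FTC_Icc_real P) auto
  have G: "has_bochner_integral lborel G
    (a * (s - (- s)) + b * ((ln 1 - ln s) + ((\<lambda>x. - ln (- x)) (-s) - (\<lambda>x. - ln (- x)) (-1)))
     + c * (((\<lambda>x. - 1 / x) R - (\<lambda>x. - 1 / x) 1) + ((\<lambda>x. - 1 / x) (-1) - (\<lambda>x. - 1 / x) (- R))))"
    unfolding G_def using ann
    by (intro has_bochner_integral_add has_bochner_integral_mult_right
        has_bochner_integral_FTC_Icc_real)
      (auto intro!: derivative_eq_intros continuous_intros simp: power2_eq_square)
  have X: "integrable lborel X"
    using int unfolding set_integrable_def X_def A_def .
  have XH: "integrable lborel (\<lambda>\<beta>. X \<beta> - H \<beta>)"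
    using X H by (auto simp: has_bochner_integral_iff)
  \<comment> \<open>The closed intervals in \<open>H\<close> contain the points \<open>R\<close> and
    \<open>- R\<close>, which the open annulus excludes; they form a null set.\<close>
  have ne: "AE \<beta> in lborel. \<beta> \<noteq> R \<and> \<beta> \<noteq> - R"
    using AE_lborel_singleton[of R] AE_lborel_singleton[of "-R"] by eventually_elim auto
  have bound: "\<bar>X \<beta> - H \<beta>\<bar> \<le> G \<beta>" if R: "\<beta> \<noteq> R" "\<beta> \<noteq> - R" for \<beta>
  proof -
    consider "1 \<le> \<bar>\<beta>\<bar>" "\<bar>\<beta>\<bar> < R" | "\<bar>\<beta>\<bar> > R" | "\<bar>\<beta>\<bar> < 1" "\<bar>\<beta>\<bar> \<le> s" | "\<bar>\<beta>\<bar> < 1" "s < \<bar>\<beta>\<bar>"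
      using R by linarith
    then show ?thesis
    proof cases
      case 1
      have "c / \<beta>\<^sup>2 \<le> G \<beta>"
        using 1 ann nonneg by (auto simp: G_def indicator_def abs_if split: if_splits)
      moreover have "X \<beta> - H \<beta> = h \<beta> - p \<beta>"
        using 1 ann by (auto simp: X_def H_def A_def indicator_def abs_if split: if_splits)
      then have "\<bar>X \<beta> - H \<beta>\<bar> \<le> c / \<beta>\<^sup>2"
        using far[of \<beta>] 1 by simp
      ultimately show ?thesis by simp
    next
      case 2
      then show ?thesis using ann nonneg
        by (auto simp: G_def X_def H_def A_def indicator_def)
    next
      case 3
      have "a \<le> G \<beta>"
        using 3 ann nonneg by (auto simp: G_def indicator_def abs_if split: if_splits)
      moreover have "\<bar>X \<beta> - H \<beta>\<bar> \<le> a"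
        using 3 ann nonneg near[of \<beta>] by (auto simp: X_def H_def A_def indicator_def)
      ultimately show ?thesis by simp
    next
      case 4
      have "b / \<bar>\<beta>\<bar> \<le> G \<beta>"
        using 4 ann nonneg by (auto simp: G_def indicator_def abs_if split: if_splits)
      moreover have "\<bar>X \<beta> - H \<beta>\<bar> \<le> b / \<bar>\<beta>\<bar>"
        using 4 ann nonneg mid[of \<beta>] by (auto simp: X_def H_def A_def indicator_def)
      ultimately show ?thesis by simp
    qed
  qed
  have "\<bar>\<integral>\<beta>. X \<beta> - H \<beta> \<partial>lborel\<bar> \<le> (\<integral>\<beta>. \<bar>X \<beta> - H \<beta>\<bar> \<partial>lborel)"
    by (rule integral_abs_bound)
  also have "\<dots> \<le> (\<integral>\<beta>. G \<beta> \<partial>lborel)"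
    using XH G ne by (intro integral_mono_AE) (auto simp: has_bochner_integral_iff intro: bound)
  also have "\<dots> = 2 * a * s + 2 * b * (- ln s) + 2 * c - 2 * (c / R)"
    using has_bochner_integral_integral_eq[OF G] ann by (simp add: algebra_simps)
  also have "\<dots> \<le> 2 * a * s + 2 * b * (- ln s) + 2 * c"
    using ann nonneg by simp
  finally have "\<bar>(\<integral>\<beta>. X \<beta> \<partial>lborel) - ((P R - P 1) + (P (-1) - P (- R)))\<bar>
    \<le> 2 * a * s + 2 * b * (- ln s) + 2 * c"
    using X H by (simp add: has_bochner_integral_iff)
  then show ?thesis
    unfolding set_lebesgue_integral_def X_def A_def by linarith
qed

lemma eventually_truncation:
  "\<forall>\<^sub>F x in at_right (0::real) \<times>\<^sub>F at_top. 0 < fst x \<and> fst x < 1 \<and> (1::real) < snd x"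
proof -
  have "\<forall>\<^sub>F \<epsilon> in at_right (0::real). 0 < \<epsilon> \<and> \<epsilon> < 1"
    using eventually_at_right_real[of 0 1] by (auto elim: eventually_mono)
  moreover have "\<forall>\<^sub>F R in at_top. 1 < (R::real)"
    by (rule eventually_gt_at_top)
  ultimately show ?thesis
    unfolding eventually_prod_filter by fastforce
qed

lemma has_pv_integral_abs_le:
  assumes "has_pv_integral h I"
    and "\<And>\<epsilon> R. 0 < \<epsilon> \<Longrightarrow> \<epsilon> < 1 \<Longrightarrow> 1 < R \<Longrightarrow>
      \<bar>set_lebesgue_integral lborel {\<beta>. \<epsilon> < \<bar>\<beta>\<bar> \<and> \<bar>\<beta>\<bar> < R} h\<bar> \<le> B"
  shows "\<bar>I\<bar> \<le> B"
proof (rule tendsto_upperbound)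
  show "((\<lambda>x. \<bar>(\<lambda>(\<epsilon>, R). set_lebesgue_integral lborel {\<beta>. \<epsilon> < \<bar>\<beta>\<bar> \<and> \<bar>\<beta>\<bar> < R} h) x\<bar>) \<longlongrightarrow> \<bar>I\<bar>)
       (at_right (0::real) \<times>\<^sub>F (at_top :: real filter))"
    using assms(1) unfolding has_pv_integral_def by (intro tendsto_rabs) auto
  show "\<forall>\<^sub>F x in at_right (0::real) \<times>\<^sub>F (at_top :: real filter).
      \<bar>(\<lambda>(\<epsilon>, R). set_lebesgue_integral lborel {\<beta>. \<epsilon> < \<bar>\<beta>\<bar> \<and> \<bar>\<beta>\<bar> < R} h) x\<bar> \<le> B"
    using eventually_truncation by eventually_elim (auto simp: assms(2))
qed (simp add: prod_filter_eq_bot)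

lemma has_pv_integral_diff:
  assumes "has_pv_integral h I" "has_pv_integral k J"
  shows "has_pv_integral (\<lambda>\<beta>. h \<beta> - k \<beta>) (I - J)"
proof -
  define F where "F = at_right (0::real) \<times>\<^sub>F (at_top :: real filter)"
  define A where "A = (\<lambda>(\<epsilon>, R). {\<beta>::real. \<epsilon> < \<bar>\<beta>\<bar> \<and> \<bar>\<beta>\<bar> < R})"
  have int: "set_integrable lborel (A (\<epsilon>, R)) h" "set_integrable lborel (A (\<epsilon>, R)) k"
    if "0 < \<epsilon>" "\<epsilon> < R" for \<epsilon> R
    using assms that by (auto simp: has_pv_integral_def A_def)
  have lim: "((\<lambda>x. set_lebesgue_integral lborel (A x) h - set_lebesgue_integral lborel (A x) k) \<longlongrightarrow> I - J) F"
    using assms by (intro tendsto_diff) (auto simp: has_pv_integral_def A_def F_def split_beta')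
  have "\<forall>\<^sub>F x in F. set_lebesgue_integral lborel (A x) h - set_lebesgue_integral lborel (A x) k
      = set_lebesgue_integral lborel (A x) (\<lambda>\<beta>. h \<beta> - k \<beta>)"
    using eventually_truncation unfolding F_def
    by eventually_elim (auto simp: set_integral_diff int)
  with lim have "((\<lambda>x. set_lebesgue_integral lborel (A x) (\<lambda>\<beta>. h \<beta> - k \<beta>)) \<longlongrightarrow> I - J) F"
    by (rule Lim_transform_eventually)
  then show ?thesis
    using int unfolding has_pv_integral_def A_def F_def by (auto simp: split_beta')
qed


section \<open>Relative velocity at a point of minimal distance\<close>

text \<open>The three bounds are the efficient ones for \<open>\<bar>\<beta>\<bar> \<le> S\<close>, \<open>S \<le> \<bar>\<beta>\<bar> \<le> 1\<close> and
  \<open>1 \<le> \<bar>\<beta>\<bar>\<close> respectively.\<close>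

lemma inverse_weight_diff_bounds:
  fixes A B S \<beta> N :: real
  assumes "\<beta> \<noteq> 0" "B = A - S" "0 \<le> S"
  shows "\<bar>1 / (\<beta>\<^sup>2 + A\<^sup>2) - 1 / (\<beta>\<^sup>2 + B\<^sup>2)\<bar> \<le> 1 / \<beta>\<^sup>2"
    and "\<bar>1 / (\<beta>\<^sup>2 + A\<^sup>2) - 1 / (\<beta>\<^sup>2 + B\<^sup>2)\<bar> \<le> S / (\<bar>\<beta>\<bar> * \<beta>\<^sup>2)"
    and "\<bar>A\<bar> \<le> 2 * N \<Longrightarrow> \<bar>B\<bar> \<le> 2 * N \<Longrightarrow>
      \<bar>1 / (\<beta>\<^sup>2 + A\<^sup>2) - 1 / (\<beta>\<^sup>2 + B\<^sup>2)\<bar> \<le> 4 * N * S / (\<beta>\<^sup>2)\<^sup>2"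
proof -
  define a b where "a = \<beta>\<^sup>2 + A\<^sup>2" and "b = \<beta>\<^sup>2 + B\<^sup>2"
  have b2: "0 < \<beta>\<^sup>2" using assms by simp
  have ab: "\<beta>\<^sup>2 \<le> a" "\<beta>\<^sup>2 \<le> b" by (auto simp: a_def b_def)
  have pos: "0 < a" "0 < b" using ab b2 by linarith+
  have inv: "0 \<le> 1 / a" "1 / a \<le> 1 / \<beta>\<^sup>2" "0 \<le> 1 / b" "1 / b \<le> 1 / \<beta>\<^sup>2"
    using ab b2 pos by (auto intro: divide_left_mono simp: frac_le)
  then show "\<bar>1 / (\<beta>\<^sup>2 + A\<^sup>2) - 1 / (\<beta>\<^sup>2 + B\<^sup>2)\<bar> \<le> 1 / \<beta>\<^sup>2"
    unfolding a_def b_def by linarith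
  have "1 / a - 1 / b = (b - a) / (a * b)" using pos by (simp add: field_simps)
  also have "b - a = - S * (A + B)" unfolding assms(2)
    by (simp add: a_def b_def assms(2) power2_eq_square algebra_simps)
  finally have eq: "\<bar>1 / a - 1 / b\<bar> = S * \<bar>A + B\<bar> / (a * b)"
    using pos assms(3) by (simp add: abs_mult)
  have amgm: "2 * \<bar>\<beta>\<bar> * \<bar>x\<bar> \<le> \<beta>\<^sup>2 + x\<^sup>2" for x
    using sum_squares_bound[of "\<bar>\<beta>\<bar>" "\<bar>x\<bar>"] by simp
  \<comment> \<open>After the triangle inequality for \<open>A + B\<close>, one denominator absorbs
    \<open>2 * \<bar>\<beta>\<bar> * \<bar>A\<bar>\<close> by \<open>amgm\<close> and the other
    absorbs \<open>\<beta>\<^sup>2\<close>; for \<open>B\<close> the roles are exchanged.\<close>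
  have "2 * \<bar>\<beta>\<bar> * \<beta>\<^sup>2 * \<bar>A + B\<bar> \<le> \<beta>\<^sup>2 * (2 * \<bar>\<beta>\<bar> * \<bar>A\<bar>) + \<beta>\<^sup>2 * (2 * \<bar>\<beta>\<bar> * \<bar>B\<bar>)"
  proof -
    have "2 * \<bar>\<beta>\<bar> * \<beta>\<^sup>2 * \<bar>A + B\<bar> \<le> 2 * \<bar>\<beta>\<bar> * \<beta>\<^sup>2 * (\<bar>A\<bar> + \<bar>B\<bar>)"
      by (intro mult_left_mono) auto
    then show ?thesis by (simp add: algebra_simps)
  qed
  also have "\<dots> \<le> \<beta>\<^sup>2 * a + \<beta>\<^sup>2 * b"
    unfolding a_def b_def by (intro add_mono mult_left_mono amgm) auto
  also have "\<dots> \<le> b * a + a * b"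
    using ab pos by (intro add_mono mult_right_mono) auto
  finally have "\<bar>\<beta>\<bar> * \<beta>\<^sup>2 * \<bar>A + B\<bar> \<le> a * b" by simp
  then have "S * (\<bar>\<beta>\<bar> * \<beta>\<^sup>2 * \<bar>A + B\<bar>) \<le> S * (a * b)"
    using assms(3) by (rule mult_left_mono)
  then have "S * \<bar>A + B\<bar> / (a * b) \<le> S / (\<bar>\<beta>\<bar> * \<beta>\<^sup>2)"
    using pos b2 assms(1) by (simp add: divide_le_eq le_divide_eq mult_ac)
  then show "\<bar>1 / (\<beta>\<^sup>2 + A\<^sup>2) - 1 / (\<beta>\<^sup>2 + B\<^sup>2)\<bar> \<le> S / (\<bar>\<beta>\<bar> * \<beta>\<^sup>2)"
    using eq by (simp add: a_def b_def)
  show "\<bar>1 / (\<beta>\<^sup>2 + A\<^sup>2) - 1 / (\<beta>\<^sup>2 + B\<^sup>2)\<bar> \<le> 4 * N * S / (\<beta>\<^sup>2)\<^sup>2"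
    if "\<bar>A\<bar> \<le> 2 * N" "\<bar>B\<bar> \<le> 2 * N"
  proof -
    have "S * \<bar>A + B\<bar> / (a * b) \<le> S * (4 * N) / (\<beta>\<^sup>2 * \<beta>\<^sup>2)"
      using that ab b2 pos assms(3)
      by (intro frac_le mult_left_mono mult_mono mult_nonneg_nonneg) auto
    then show ?thesis
      using eq by (simp add: a_def b_def power2_eq_square[of "\<beta>\<^sup>2"] mult_ac)
  qed
qed

text \<open>A slope difference of size \<open>M * \<bar>\<beta>\<bar>\<close> makes the numerator at
  most \<open>M * \<beta>\<^sup>2\<close>, which cancels one factor
  \<open>1 / \<beta>\<^sup>2\<close> in each bound for the weights. The outcome has the three shapes
  that \<open>annulus_integral_bound\<close> integrates.\<close>

lemma kernel_diff_bounds: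
  fixes A B S \<beta> N D M :: real
  assumes "\<beta> \<noteq> 0" "B = A - S" "0 \<le> S" and D: "\<bar>D\<bar> \<le> M * \<bar>\<beta>\<bar>"
  shows "\<bar>\<beta> * D / (\<beta>\<^sup>2 + A\<^sup>2) - \<beta> * D / (\<beta>\<^sup>2 + B\<^sup>2)\<bar> \<le> M"
    and "\<bar>\<beta> * D / (\<beta>\<^sup>2 + A\<^sup>2) - \<beta> * D / (\<beta>\<^sup>2 + B\<^sup>2)\<bar> \<le> M * S / \<bar>\<beta>\<bar>"
    and "\<bar>A\<bar> \<le> 2 * N \<Longrightarrow> \<bar>B\<bar> \<le> 2 * N \<Longrightarrow>
      \<bar>\<beta> * D / (\<beta>\<^sup>2 + A\<^sup>2) - \<beta> * D / (\<beta>\<^sup>2 + B\<^sup>2)\<bar> \<le> 4 * M * N * S / \<beta>\<^sup>2"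
proof -
  have "0 \<le> M * \<bar>\<beta>\<bar>" using D by linarith
  then have M: "0 \<le> M" using assms(1) by (simp add: zero_le_mult_iff)
  have "\<bar>\<beta> * D\<bar> \<le> \<bar>\<beta>\<bar> * (M * \<bar>\<beta>\<bar>)"
    unfolding abs_mult by (intro mult_left_mono D) auto
  then have bD: "\<bar>\<beta> * D\<bar> \<le> M * \<beta>\<^sup>2"
    by (simp add: power2_eq_square mult_ac)
  have eq: "\<bar>\<beta> * D / (\<beta>\<^sup>2 + A\<^sup>2) - \<beta> * D / (\<beta>\<^sup>2 + B\<^sup>2)\<bar>
      = \<bar>\<beta> * D\<bar> * \<bar>1 / (\<beta>\<^sup>2 + A\<^sup>2) - 1 / (\<beta>\<^sup>2 + B\<^sup>2)\<bar>"
    by (simp add: abs_mult[symmetric] algebra_simps)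
  have le: "\<bar>\<beta> * D / (\<beta>\<^sup>2 + A\<^sup>2) - \<beta> * D / (\<beta>\<^sup>2 + B\<^sup>2)\<bar> \<le> M * \<beta>\<^sup>2 * w"
    if "\<bar>1 / (\<beta>\<^sup>2 + A\<^sup>2) - 1 / (\<beta>\<^sup>2 + B\<^sup>2)\<bar> \<le> w" for w
    unfolding eq using bD that M by (intro mult_mono) auto
  note * = inverse_weight_diff_bounds[OF assms(1-3)]
  show "\<bar>\<beta> * D / (\<beta>\<^sup>2 + A\<^sup>2) - \<beta> * D / (\<beta>\<^sup>2 + B\<^sup>2)\<bar> \<le> M"
    using le[OF *(1)] assms(1) by simp
  show "\<bar>\<beta> * D / (\<beta>\<^sup>2 + A\<^sup>2) - \<beta> * D / (\<beta>\<^sup>2 + B\<^sup>2)\<bar> \<le> M * S / \<bar>\<beta>\<bar>"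
    using le[OF *(2)] assms(1) by simp
  show "\<bar>\<beta> * D / (\<beta>\<^sup>2 + A\<^sup>2) - \<beta> * D / (\<beta>\<^sup>2 + B\<^sup>2)\<bar> \<le> 4 * M * N * S / \<beta>\<^sup>2"
    if "\<bar>A\<bar> \<le> 2 * N" "\<bar>B\<bar> \<le> 2 * N"
  proof -
    have "M * \<beta>\<^sup>2 * (4 * N * S / (\<beta>\<^sup>2)\<^sup>2) = 4 * M * N * S / \<beta>\<^sup>2"
      using assms(1) unfolding power2_eq_square[of "\<beta>\<^sup>2"] by (simp add: divide_simps)
    then show ?thesis using le[OF *(3)[OF that]] by simp
  qed
qed

lemma abs_diff_le_of_deriv_bound:
  fixes F F' :: "real \<Rightarrow> real"
  assumes "\<And>x. (F has_real_derivative F' x) (at x)" "\<And>x. \<bar>F' x\<bar> \<le> M"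
  shows "\<bar>F x - F y\<bar> \<le> M * \<bar>x - y\<bar>"
  using field_differentiable_bound[of UNIV F F' M x y] assms by simp

text \<open>The mean slope over an interval of length one is at most \<open>2 * M\<close>, and the
  slope varies there by at most \<open>M\<close>. This supplies bounds on first derivatives, which
  \<open>smooth_free_boundary\<close> does not impose.\<close>

lemma abs_deriv_le:
  fixes F F' F'' :: "real \<Rightarrow> real"
  assumes "\<And>x. (F has_real_derivative F' x) (at x)" "\<And>x. (F' has_real_derivative F'' x) (at x)"
    and "\<And>x. \<bar>F x\<bar> \<le> M" "\<And>x. \<bar>F'' x\<bar> \<le> M"
  shows "\<bar>F' x\<bar> \<le> 3 * M"
proof -
  obtain z where z: "x < z" "z < x + 1" "F (x + 1) - F x = (x + 1 - x) * F' z"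
    using MVT2[of x "x + 1" F F'] assms(1) by auto
  have "\<bar>F' x - F' z\<bar> \<le> M * \<bar>x - z\<bar>"
    using assms by (intro abs_diff_le_of_deriv_bound) auto
  also have "\<dots> \<le> M * 1"
    using z assms(3)[of 0] by (intro mult_left_mono) auto
  finally show ?thesis
    using z assms(3)[of x] assms(3)[of "x + 1"] by auto
qed

text \<open>At a point of minimal distance both curves have the same slope, so the integrand of the
  relative velocity is a combination of differences of kernels with equal slope factors.\<close>

lemma relative_velocity_at_minimum:
  fixes f g f2 g2 :: "real \<Rightarrow> real"
  assumes f: "\<And>x. (f has_real_derivative deriv f x) (at x)"
      "\<And>x. (deriv f has_real_derivative f2 x) (at x)"
    and g: "\<And>x. (g has_real_derivative deriv g x) (at x)"
      "\<And>x. (deriv g has_real_derivative g2 x) (at x)"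
    and bounds: "\<And>x. \<bar>f x\<bar> \<le> Nf" "\<And>x. \<bar>g x\<bar> \<le> Ng" "\<And>x. \<bar>f2 x\<bar> \<le> Mf" "\<And>x. \<bar>g2 x\<bar> \<le> Mg"
    and S: "f \<alpha> - g \<alpha> = S" "0 < S" "S \<le> exp (- 1)"
    and slope: "deriv f \<alpha> = deriv g \<alpha>"
    and ab: "0 \<le> a" "0 \<le> b"
    and vf: "has_pv_integral (\<lambda>\<beta>. a * muskat_kernel f f \<alpha> \<beta> + b * muskat_kernel f g \<alpha> \<beta>) vf"
    and vg: "has_pv_integral (\<lambda>\<beta>. b * muskat_kernel g g \<alpha> \<beta> + a * muskat_kernel g f \<alpha> \<beta>) vg"
  shows "\<bar>vf - vg\<bar> \<le> 8 * (a + b) * (Mf + Mg) * (Nf + Ng + 1) * (S * (- ln S))"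
proof -
  define h where "h \<beta> = (a * muskat_kernel f f \<alpha> \<beta> + b * muskat_kernel f g \<alpha> \<beta>)
     - (b * muskat_kernel g g \<alpha> \<beta> + a * muskat_kernel g f \<alpha> \<beta>)" for \<beta>
  define M N where "M = Mf + Mg" and "N = Nf + Ng"
  have nonneg: "0 \<le> Nf" "0 \<le> Ng" "0 \<le> Mf" "0 \<le> Mg"
    using bounds[of 0] by linarith+
  then have MN: "0 \<le> M" "0 \<le> N" by (auto simp: M_def N_def)
  \<comment> \<open>Equality of slopes is applied to the mixed kernels: at \<open>\<alpha>\<close>,
    \<open>deriv g\<close> replaces \<open>deriv f\<close> in \<open>muskat_kernel f g\<close> and
    \<open>deriv f\<close> replaces \<open>deriv g\<close> in \<open>muskat_kernel g f\<close>, so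
    each numerator compares slopes of a single curve.\<close>
  have h: "h \<beta> = a * (\<beta> * (deriv f \<alpha> - deriv f (\<alpha> - \<beta>)) / (\<beta>\<^sup>2 + (f \<alpha> - f (\<alpha> - \<beta>))\<^sup>2)
        - \<beta> * (deriv f \<alpha> - deriv f (\<alpha> - \<beta>)) / (\<beta>\<^sup>2 + (g \<alpha> - f (\<alpha> - \<beta>))\<^sup>2))
      + b * (\<beta> * (deriv g \<alpha> - deriv g (\<alpha> - \<beta>)) / (\<beta>\<^sup>2 + (f \<alpha> - g (\<alpha> - \<beta>))\<^sup>2)
        - \<beta> * (deriv g \<alpha> - deriv g (\<alpha> - \<beta>)) / (\<beta>\<^sup>2 + (g \<alpha> - g (\<alpha> - \<beta>))\<^sup>2))" for \<beta>
    unfolding h_def muskat_kernel_def using slope by (simp add: algebra_simps)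
  have df: "\<bar>deriv f \<alpha> - deriv f (\<alpha> - \<beta>)\<bar> \<le> M * \<bar>\<beta>\<bar>" for \<beta>
    using abs_diff_le_of_deriv_bound[OF f(2) bounds(3), of \<alpha> "\<alpha> - \<beta>"] nonneg
    by (simp add: M_def algebra_simps) (smt (verit) abs_ge_zero mult_nonneg_nonneg)
  have dg: "\<bar>deriv g \<alpha> - deriv g (\<alpha> - \<beta>)\<bar> \<le> M * \<bar>\<beta>\<bar>" for \<beta>
    using abs_diff_le_of_deriv_bound[OF g(2) bounds(4), of \<alpha> "\<alpha> - \<beta>"] nonneg
    by (simp add: M_def algebra_simps) (smt (verit) abs_ge_zero mult_nonneg_nonneg)
  have comb: "\<bar>h \<beta>\<bar> \<le> (a + b) * w"
    if "\<bar>\<beta> * (deriv f \<alpha> - deriv f (\<alpha> - \<beta>)) / (\<beta>\<^sup>2 + (f \<alpha> - f (\<alpha> - \<beta>))\<^sup>2)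
        - \<beta> * (deriv f \<alpha> - deriv f (\<alpha> - \<beta>)) / (\<beta>\<^sup>2 + (g \<alpha> - f (\<alpha> - \<beta>))\<^sup>2)\<bar> \<le> w"
      and "\<bar>\<beta> * (deriv g \<alpha> - deriv g (\<alpha> - \<beta>)) / (\<beta>\<^sup>2 + (f \<alpha> - g (\<alpha> - \<beta>))\<^sup>2)
        - \<beta> * (deriv g \<alpha> - deriv g (\<alpha> - \<beta>)) / (\<beta>\<^sup>2 + (g \<alpha> - g (\<alpha> - \<beta>))\<^sup>2)\<bar> \<le> w" for \<beta> w
    unfolding h distrib_right
    using ab that by (intro order_trans[OF abs_triangle_ineq] add_mono)
      (auto simp: abs_mult intro!: mult_left_mono)
  have f': "g \<alpha> - f (\<alpha> - \<beta>) = (f \<alpha> - f (\<alpha> - \<beta>)) - S"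
    and g': "g \<alpha> - g (\<alpha> - \<beta>) = (f \<alpha> - g (\<alpha> - \<beta>)) - S" for \<beta>
    using S by auto
  note kf = kernel_diff_bounds[OF _ f' less_imp_le[OF S(2)] df]
  note kg = kernel_diff_bounds[OF _ g' less_imp_le[OF S(2)] dg]
  have small: "\<bar>f \<alpha> - f (\<alpha> - \<beta>)\<bar> \<le> 2 * N" "\<bar>g \<alpha> - f (\<alpha> - \<beta>)\<bar> \<le> 2 * N"
    "\<bar>f \<alpha> - g (\<alpha> - \<beta>)\<bar> \<le> 2 * N" "\<bar>g \<alpha> - g (\<alpha> - \<beta>)\<bar> \<le> 2 * N" for \<beta>
    using bounds(1)[of \<alpha>] bounds(1)[of "\<alpha> - \<beta>"] bounds(2)[of \<alpha>] bounds(2)[of "\<alpha> - \<beta>"] nonneg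
    unfolding N_def by (smt (verit))+
  have S1: "S < 1" using S(3) by (smt (verit) exp_less_one_iff)
  have lnS: "1 \<le> - ln S" using S by (metis ln_exp ln_le_cancel_iff exp_gt_zero le_minus_iff)
  have vh: "has_pv_integral h (vf - vg)"
    unfolding h_def by (rule has_pv_integral_diff[OF vf vg])
  have "\<bar>vf - vg\<bar> \<le> 2 * ((a + b) * M) * S + 2 * ((a + b) * (M * S)) * (- ln S)
      + 2 * ((a + b) * (4 * M * N * S))"
  proof (rule has_pv_integral_abs_le[OF vh])
    fix \<epsilon> R :: real assume eR: "0 < \<epsilon>" "\<epsilon> < 1" "1 < R"
    have "\<bar>set_lebesgue_integral lborel {\<beta>. \<epsilon> < \<bar>\<beta>\<bar> \<and> \<bar>\<beta>\<bar> < R} h\<bar>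
      \<le> 2 * ((a + b) * M) * S + 2 * ((a + b) * (M * S)) * (- ln S)
      + 2 * ((a + b) * (4 * M * N * S)) + \<bar>0 - 0 + 0 - 0\<bar>"
    \<comment> \<open>The differences already decay like \<open>1 / \<beta>\<^sup>2\<close>, so
      nothing has to be integrated exactly. The inner cut is at \<open>S\<close>, where the bounds
      \<open>M\<close> and \<open>M * S / \<bar>\<beta>\<bar>\<close> coincide.\<close>
    proof (rule annulus_integral_bound[where P = "\<lambda>_. 0" and p = "\<lambda>_. 0"])
      show "set_integrable lborel {\<beta>. \<epsilon> < \<bar>\<beta>\<bar> \<and> \<bar>\<beta>\<bar> < R} h"
        using vh eR unfolding has_pv_integral_def by auto
      show "\<bar>h \<beta>\<bar> \<le> (a + b) * M" if "0 < \<bar>\<beta>\<bar>" for \<beta>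
        using that by (intro comb kf(1) kg(1)) auto
      show "\<bar>h \<beta>\<bar> \<le> (a + b) * (M * S) / \<bar>\<beta>\<bar>" if "S < \<bar>\<beta>\<bar>" for \<beta>
      proof -
        have "\<bar>h \<beta>\<bar> \<le> (a + b) * (M * S / \<bar>\<beta>\<bar>)"
          using that S(2) by (intro comb kf(2) kg(2)) auto
        then show ?thesis by simp
      qed
      show "\<bar>h \<beta> - 0\<bar> \<le> (a + b) * (4 * M * N * S) / \<beta>\<^sup>2" if "1 \<le> \<bar>\<beta>\<bar>" for \<beta>
      proof -
        have "\<bar>h \<beta>\<bar> \<le> (a + b) * (4 * M * N * S / \<beta>\<^sup>2)"
          using that by (intro comb kf(3) kg(3) small) auto
        then show ?thesis by simp
      qed
    qed (use S S1 eR ab MN in auto)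
    then show "\<bar>set_lebesgue_integral lborel {\<beta>. \<epsilon> < \<bar>\<beta>\<bar> \<and> \<bar>\<beta>\<bar> < R} h\<bar>
      \<le> 2 * ((a + b) * M) * S + 2 * ((a + b) * (M * S)) * (- ln S)
      + 2 * ((a + b) * (4 * M * N * S))" by simp
  qed
  also have "\<dots> = (a + b) * M * S * (2 + 2 * (- ln S) + 8 * N)"
    by (simp add: algebra_simps)
  \<comment> \<open>The factor \<open>- ln S\<close> is at least 1 because
    \<open>S \<le> exp (- 1)\<close>, so it absorbs the contributions without a logarithm. The
    constant 8 arises here.\<close>
  also have "\<dots> \<le> (a + b) * M * S * (8 * (N + 1) * (- ln S))"
  proof (rule mult_left_mono)
    have "8 * N * 1 \<le> 8 * N * (- ln S)"
      using MN lnS by (intro mult_left_mono) auto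
    then show "2 + 2 * (- ln S) + 8 * N \<le> 8 * (N + 1) * (- ln S)"
      using lnS by (simp add: algebra_simps)
  qed (use ab MN S in auto)
  also have "\<dots> = 8 * (a + b) * (Mf + Mg) * (Nf + Ng + 1) * (S * (- ln S))"
    by (simp add: M_def N_def algebra_simps)
  finally show ?thesis .
qed


section \<open>A crude velocity bound at arbitrary points\<close>

lemma isCont_muskat_kernel:
  assumes "\<And>x. isCont g x" "\<And>x. isCont (deriv g) x" "\<beta> \<noteq> 0"
  shows "isCont (muskat_kernel f g \<alpha>) \<beta>"
proof -
  have "isCont (\<lambda>\<beta>. g (\<alpha> - \<beta>)) \<beta>" "isCont (\<lambda>\<beta>. deriv g (\<alpha> - \<beta>)) \<beta>"
    by (rule isCont_o2[where f = "\<lambda>\<beta>. \<alpha> - \<beta>"], simp_all add: assms)+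
  then show ?thesis
    unfolding muskat_kernel_def
    by (intro continuous_intros) (use assms(3) in \<open>auto simp: add_nonneg_eq_0_iff\<close>)
qed

lemma set_integrable_annulus:
  fixes h :: "real \<Rightarrow> real"
  assumes "0 < \<epsilon>" "\<And>\<beta>. \<beta> \<noteq> 0 \<Longrightarrow> isCont h \<beta>"
  shows "set_integrable lborel {\<beta>. \<epsilon> < \<bar>\<beta>\<bar> \<and> \<bar>\<beta>\<bar> < R} h"
proof -
  have "set_integrable lborel ({-R..-\<epsilon>} \<union> {\<epsilon>..R}) h"
    unfolding set_integrable_def using assms
    by (intro borel_integrable_compact compact_Un continuous_at_imp_continuous_on) auto
  then show ?thesis
    by (rule set_integrable_subset) auto
qed

text \<open>Away from the singularity the kernel is the derivative of
  \<open>g (\<alpha> - \<beta>) / \<beta> + deriv f \<alpha> * ln \<bar>\<beta>\<bar>\<close> up to \<open>O(1 / \<beta>\<^sup>2)\<close>, and the logarithms cancel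
  over a symmetric annulus.\<close>

lemma truncated_muskat_kernel_bound:
  assumes g: "\<And>x. (g has_real_derivative deriv g x) (at x)" "\<And>x. isCont (deriv g) x"
    and bounds: "\<And>x. \<bar>f x\<bar> \<le> N" "\<And>x. \<bar>g x\<bar> \<le> N" "\<And>x. \<bar>deriv f x\<bar> \<le> L" "\<And>x. \<bar>deriv g x\<bar> \<le> L"
    and near: "\<And>\<beta>. \<beta> \<noteq> 0 \<Longrightarrow> \<bar>\<beta>\<bar> < 1 \<Longrightarrow> \<bar>muskat_kernel f g \<alpha> \<beta>\<bar> \<le> Q"
    and ann: "0 < \<epsilon>" "\<epsilon> < 1" "1 < R"
  shows "\<bar>set_lebesgue_integral lborel {\<beta>. \<epsilon> < \<bar>\<beta>\<bar> \<and> \<bar>\<beta>\<bar> < R} (muskat_kernel f g \<alpha>)\<bar>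
    \<le> 2 * Q + (16 * L * N\<^sup>2 + 6 * N)"
proof -
  \<comment> \<open>\<open>ln (\<beta>\<^sup>2) / 2\<close> is \<open>ln \<bar>\<beta>\<bar>\<close>
    in a form that can be differentiated for both signs of \<open>\<beta>\<close> at once.\<close>
  define P where "P \<beta> = g (\<alpha> - \<beta>) / \<beta> + deriv f \<alpha> / 2 * ln (\<beta>\<^sup>2)" for \<beta>
  define p where "p \<beta> = - deriv g (\<alpha> - \<beta>) / \<beta> - g (\<alpha> - \<beta>) / \<beta>\<^sup>2 + deriv f \<alpha> / \<beta>" for \<beta>
  have nonneg: "0 \<le> N" "0 \<le> L" using bounds(1,3)[of 0] by linarith+
  have "0 \<le> Q" using near[of "1/2"] by auto
  have isg: "isCont g x" for x using g(1) by (rule DERIV_isCont)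
  have cont: "isCont (\<lambda>\<beta>. g (\<alpha> - \<beta>)) \<beta>" "isCont (\<lambda>\<beta>. deriv g (\<alpha> - \<beta>)) \<beta>" for \<beta>
    by (rule isCont_o2[where f = "\<lambda>\<beta>. \<alpha> - \<beta>"], simp_all add: isg g(2))+
  have far: "\<bar>muskat_kernel f g \<alpha> \<beta> - p \<beta>\<bar> \<le> (8 * L * N\<^sup>2 + N) / \<beta>\<^sup>2" if "1 \<le> \<bar>\<beta>\<bar>" for \<beta>
  proof -
    define D \<Delta> where "D = deriv f \<alpha> - deriv g (\<alpha> - \<beta>)" and "\<Delta> = f \<alpha> - g (\<alpha> - \<beta>)"
    have b: "\<beta> \<noteq> 0" "0 < \<beta>\<^sup>2" using that by auto
    have pos: "0 < \<beta>\<^sup>2 + \<Delta>\<^sup>2" using b by (intro add_pos_nonneg) auto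
    \<comment> \<open>To leading order the kernel is \<open>D / \<beta>\<close>, and
      \<open>p \<beta>\<close> equals
      \<open>D / \<beta> - g (\<alpha> - \<beta>) / \<beta>\<^sup>2\<close>.\<close>
    have "muskat_kernel f g \<alpha> \<beta> - p \<beta> = (\<beta> * D / (\<beta>\<^sup>2 + \<Delta>\<^sup>2) - D / \<beta>) + g (\<alpha> - \<beta>) / \<beta>\<^sup>2"
      by (simp add: muskat_kernel_def p_def D_def \<Delta>_def diff_divide_distrib)
    also have "\<beta> * D / (\<beta>\<^sup>2 + \<Delta>\<^sup>2) - D / \<beta> = - (D * \<Delta>\<^sup>2 / (\<beta> * (\<beta>\<^sup>2 + \<Delta>\<^sup>2)))"
    proof -
      have "\<beta> * D * \<beta> - D * (\<beta>\<^sup>2 + \<Delta>\<^sup>2) = - (D * \<Delta>\<^sup>2)"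
        by (simp add: power2_eq_square algebra_simps)
      then show ?thesis
        using b pos by (subst diff_frac_eq) (auto simp: mult.commute)
    qed
    finally have eq: "muskat_kernel f g \<alpha> \<beta> - p \<beta>
      = - (D * \<Delta>\<^sup>2 / (\<beta> * (\<beta>\<^sup>2 + \<Delta>\<^sup>2))) + g (\<alpha> - \<beta>) / \<beta>\<^sup>2" .
    have D: "\<bar>D\<bar> \<le> 2 * L"
      using bounds(3)[of \<alpha>] bounds(4)[of "\<alpha> - \<beta>"] unfolding D_def by linarith
    have "\<bar>\<Delta>\<bar> \<le> 2 * N"
      using bounds(1)[of \<alpha>] bounds(2)[of "\<alpha> - \<beta>"] unfolding \<Delta>_def by linarith
    then have \<Delta>: "\<Delta>\<^sup>2 \<le> (2 * N)\<^sup>2"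
      using abs_le_square_iff[of \<Delta> "2 * N"] nonneg by simp
    have "1 * \<beta>\<^sup>2 \<le> \<bar>\<beta>\<bar> * (\<beta>\<^sup>2 + \<Delta>\<^sup>2)"
      using that by (intro mult_mono) auto
    then have "\<bar>D\<bar> * \<Delta>\<^sup>2 / (\<bar>\<beta>\<bar> * (\<beta>\<^sup>2 + \<Delta>\<^sup>2)) \<le> (2 * L) * (2 * N)\<^sup>2 / \<beta>\<^sup>2"
      using D \<Delta> b nonneg by (intro frac_le mult_mono) auto
    then have 1: "\<bar>D * \<Delta>\<^sup>2 / (\<beta> * (\<beta>\<^sup>2 + \<Delta>\<^sup>2))\<bar> \<le> 8 * L * N\<^sup>2 / \<beta>\<^sup>2"
      using pos by (simp add: abs_mult power_mult_distrib)
    have 2: "\<bar>g (\<alpha> - \<beta>) / \<beta>\<^sup>2\<bar> \<le> N / \<beta>\<^sup>2"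
      using bounds(2) b by (simp add: divide_right_mono)
    show ?thesis
      unfolding eq add_divide_distrib using 1 2 by linarith
  qed
  have P1: "(P has_real_derivative p \<beta>) (at \<beta>)" if "1 \<le> \<bar>\<beta>\<bar>" for \<beta>
  proof -
    have "\<beta> \<noteq> 0" using that by auto
    have "((\<lambda>\<beta>. g (\<alpha> - \<beta>)) has_real_derivative deriv g (\<alpha> - \<beta>) * (0 - 1)) (at \<beta>)"
      by (rule DERIV_chain2[OF g(1)]) (auto intro!: derivative_eq_intros)
    from this \<open>\<beta> \<noteq> 0\<close> have "((\<lambda>\<beta>. g (\<alpha> - \<beta>) / \<beta>) has_real_derivative
        (deriv g (\<alpha> - \<beta>) * (0 - 1) * \<beta> - g (\<alpha> - \<beta>) * 1) / (\<beta> * \<beta>)) (at \<beta>)"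
      by (intro DERIV_divide DERIV_ident)
    moreover have "((\<lambda>\<beta>. deriv f \<alpha> / 2 * ln (\<beta>\<^sup>2)) has_real_derivative
        deriv f \<alpha> / 2 * (1 / \<beta>\<^sup>2 * (2 * \<beta>))) (at \<beta>)"
      using \<open>\<beta> \<noteq> 0\<close> by (auto intro!: derivative_eq_intros)
    ultimately have "(P has_real_derivative
        (deriv g (\<alpha> - \<beta>) * (0 - 1) * \<beta> - g (\<alpha> - \<beta>) * 1) / (\<beta> * \<beta>)
        + deriv f \<alpha> / 2 * (1 / \<beta>\<^sup>2 * (2 * \<beta>))) (at \<beta>)"
      unfolding P_def by (rule DERIV_add)
    moreover have "(deriv g (\<alpha> - \<beta>) * (0 - 1) * \<beta> - g (\<alpha> - \<beta>) * 1) / (\<beta> * \<beta>)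
        + deriv f \<alpha> / 2 * (1 / \<beta>\<^sup>2 * (2 * \<beta>)) = p \<beta>"
      unfolding p_def using \<open>\<beta> \<noteq> 0\<close> by (simp add: diff_divide_distrib power2_eq_square)
    ultimately show ?thesis by simp
  qed
  have p1: "isCont p \<beta>" if "1 \<le> \<bar>\<beta>\<bar>" for \<beta>
    unfolding p_def using that by (intro continuous_intros cont) auto
  \<comment> \<open>The cut at 1 makes the middle range empty, which allows the value 0 for its
    constant.\<close>
  have "\<bar>set_lebesgue_integral lborel {\<beta>. \<epsilon> < \<bar>\<beta>\<bar> \<and> \<bar>\<beta>\<bar> < R} (muskat_kernel f g \<alpha>)\<bar>
    \<le> 2 * Q * 1 + 2 * 0 * (- ln 1) + 2 * (8 * L * N\<^sup>2 + N) + \<bar>P R - P 1 + P (-1) - P (- R)\<bar>"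
  proof (rule annulus_integral_bound[where p = p and P = P and s = 1 and a = Q and b = 0])
    show "set_integrable lborel {\<beta>. \<epsilon> < \<bar>\<beta>\<bar> \<and> \<bar>\<beta>\<bar> < R} (muskat_kernel f g \<alpha>)"
      using ann(1) isCont_muskat_kernel[OF isg g(2)] by (rule set_integrable_annulus)
    show "0 \<le> 8 * L * N\<^sup>2 + N" using nonneg by simp
    show "\<bar>muskat_kernel f g \<alpha> \<beta>\<bar> \<le> Q" if "0 < \<bar>\<beta>\<bar>" "\<bar>\<beta>\<bar> < 1" for \<beta>
      using that by (intro near) auto
  qed (fact ann P1 p1 far \<open>0 \<le> Q\<close> | simp)+
  \<comment> \<open>The logarithms cancel in pairs and leave four values of \<open>g\<close>, each
    divided by a number of absolute value at least 1.\<close>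
  moreover have "\<bar>P R - P 1 + P (-1) - P (- R)\<bar> \<le> 4 * N"
  proof -
    have 1: "\<bar>g x / R\<bar> \<le> N" for x
    proof -
      have "\<bar>g x\<bar> / R \<le> N / 1"
        using ann bounds(2)[of x] nonneg by (intro frac_le) auto
      then show ?thesis using ann by simp
    qed
    have "P R - P 1 + P (-1) - P (- R)
      = g (\<alpha> - R) / R - g (\<alpha> - 1) - g (\<alpha> + 1) + g (\<alpha> + R) / R"
      by (simp add: P_def)
    then show ?thesis
      using 1[of "\<alpha> - R"] 1[of "\<alpha> + R"] bounds(2)[of "\<alpha> - 1"] bounds(2)[of "\<alpha> + 1"]
      by linarith
  qed
  ultimately show ?thesis by simp
qed

text \<open>The slope difference vanishes to first order at \<open>\<beta> = 0\<close> and the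
  denominator is at least \<open>\<beta>\<^sup>2\<close>, so the kernel of a curve with itself has
  no singularity.\<close>

lemma muskat_kernel_same_bound:
  assumes "\<And>x. (deriv f has_real_derivative f2 x) (at x)" "\<And>x. \<bar>f2 x\<bar> \<le> M" "\<beta> \<noteq> 0"
  shows "\<bar>muskat_kernel f f \<alpha> \<beta>\<bar> \<le> M"
proof -
  have M: "0 \<le> M" using assms(2)[of 0] by linarith
  have "\<bar>deriv f \<alpha> - deriv f (\<alpha> - \<beta>)\<bar> \<le> M * \<bar>\<beta>\<bar>"
    using abs_diff_le_of_deriv_bound[OF assms(1,2), of \<alpha> "\<alpha> - \<beta>"] by simp
  then have "\<bar>\<beta>\<bar> * \<bar>deriv f \<alpha> - deriv f (\<alpha> - \<beta>)\<bar> \<le> \<bar>\<beta>\<bar> * (M * \<bar>\<beta>\<bar>)"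
    by (rule mult_left_mono) simp
  also have "\<dots> = M * \<beta>\<^sup>2" by (simp add: power2_eq_square)
  also have "\<dots> \<le> M * (\<beta>\<^sup>2 + (f \<alpha> - f (\<alpha> - \<beta>))\<^sup>2)"
    using M by (intro mult_left_mono) auto
  finally show ?thesis
    using assms(3) by (simp add: muskat_kernel_def abs_mult divide_le_eq add_pos_nonneg)
qed

text \<open>Bounded slopes keep the two curves apart near \<open>\<alpha>\<close>: the gap at
  \<open>\<alpha>\<close> is at most \<open>\<bar>\<Delta>\<bar> + L * \<bar>\<beta>\<bar>\<close>,
  so the denominator is at least a fixed multiple of the squared gap.\<close>

lemma muskat_kernel_gap_bound:
  assumes g: "\<And>x. (g has_real_derivative deriv g x) (at x)"
    and bounds: "\<And>x. \<bar>deriv f x\<bar> \<le> L" "\<And>x. \<bar>deriv g x\<bar> \<le> L"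
    and "f \<alpha> \<noteq> g \<alpha>" "\<beta> \<noteq> 0" "\<bar>\<beta>\<bar> < 1"
  shows "\<bar>muskat_kernel f g \<alpha> \<beta>\<bar> \<le> 4 * L * (1 + L\<^sup>2) / (f \<alpha> - g \<alpha>)\<^sup>2"
proof -
  define u \<Delta> where "u = f \<alpha> - g \<alpha>" and "\<Delta> = f \<alpha> - g (\<alpha> - \<beta>)"
  have L: "0 \<le> L" using bounds(1)[of 0] by linarith
  have pos: "0 < \<beta>\<^sup>2 + \<Delta>\<^sup>2" "0 < u\<^sup>2" using assms by (auto simp: add_pos_nonneg u_def)
  have "\<bar>g \<alpha> - g (\<alpha> - \<beta>)\<bar> \<le> L * \<bar>\<beta>\<bar>"
    using abs_diff_le_of_deriv_bound[OF g bounds(2), of \<alpha> "\<alpha> - \<beta>"] by simp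
  then have "\<bar>u\<bar> \<le> \<bar>\<Delta>\<bar> + L * \<bar>\<beta>\<bar>" unfolding u_def \<Delta>_def by linarith
  then have "u\<^sup>2 \<le> (\<bar>\<Delta>\<bar> + L * \<bar>\<beta>\<bar>)\<^sup>2"
    using abs_le_square_iff[of u "\<bar>\<Delta>\<bar> + L * \<bar>\<beta>\<bar>"] L by simp
  also have "\<dots> \<le> 2 * (\<Delta>\<^sup>2 + L\<^sup>2 * \<beta>\<^sup>2)"
    using sum_squares_bound[of "\<bar>\<Delta>\<bar>" "L * \<bar>\<beta>\<bar>"] by (simp add: power2_sum power_mult_distrib)
  also have "\<dots> \<le> 2 * ((1 + L\<^sup>2) * (\<beta>\<^sup>2 + \<Delta>\<^sup>2))"
    by (simp add: algebra_simps)
  finally have gap: "u\<^sup>2 \<le> 2 * (1 + L\<^sup>2) * (\<beta>\<^sup>2 + \<Delta>\<^sup>2)"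
    by (simp only: mult.assoc)
  have "\<bar>deriv f \<alpha> - deriv g (\<alpha> - \<beta>)\<bar> \<le> 2 * L"
    using bounds(1)[of \<alpha>] bounds(2)[of "\<alpha> - \<beta>"] by linarith
  then have "\<bar>\<beta>\<bar> * \<bar>deriv f \<alpha> - deriv g (\<alpha> - \<beta>)\<bar> \<le> 1 * (2 * L)"
    using assms by (intro mult_mono) auto
  then have "\<bar>muskat_kernel f g \<alpha> \<beta>\<bar> \<le> 2 * L / (\<beta>\<^sup>2 + \<Delta>\<^sup>2)"
    using pos by (simp add: muskat_kernel_def \<Delta>_def[symmetric] abs_mult divide_right_mono)
  also have "\<dots> \<le> 4 * L * (1 + L\<^sup>2) / u\<^sup>2"
  proof -
    have "2 * L * u\<^sup>2 \<le> 2 * L * (2 * (1 + L\<^sup>2) * (\<beta>\<^sup>2 + \<Delta>\<^sup>2))"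
      using gap L by (intro mult_left_mono) auto
    also have "\<dots> = 4 * L * (1 + L\<^sup>2) * (\<beta>\<^sup>2 + \<Delta>\<^sup>2)" by simp
    finally show ?thesis
      by (simp only: pos_divide_le_eq[OF pos(1)] times_divide_eq_left pos_le_divide_eq[OF pos(2)])
  qed
  finally show ?thesis unfolding u_def .
qed

text \<open>Only the bound for the mixed kernel degenerates as the curves approach, and only like
  the inverse square of the gap. The factor \<open>(f \<alpha> - g \<alpha>)\<^sup>2\<close>
  compensates for this and makes the bound uniform in \<open>\<alpha>\<close>, as control of the
  cube of the gap in time requires.\<close>

lemma velocity_bound:
  fixes f g f2 g2 :: "real \<Rightarrow> real"
  assumes f: "\<And>x. (f has_real_derivative deriv f x) (at x)"
      "\<And>x. (deriv f has_real_derivative f2 x) (at x)"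
    and g: "\<And>x. (g has_real_derivative deriv g x) (at x)"
      "\<And>x. (deriv g has_real_derivative g2 x) (at x)"
    and bounds: "\<And>x. \<bar>f x\<bar> \<le> M" "\<And>x. \<bar>g x\<bar> \<le> M" "\<And>x. \<bar>f2 x\<bar> \<le> M" "\<And>x. \<bar>g2 x\<bar> \<le> M"
    and gap: "f \<alpha> \<noteq> g \<alpha>" and ab: "0 \<le> a" "0 \<le> b"
    and v: "has_pv_integral (\<lambda>\<beta>. a * muskat_kernel f f \<alpha> \<beta> + b * muskat_kernel f g \<alpha> \<beta>) v"
  shows "(f \<alpha> - g \<alpha>)\<^sup>2 * \<bar>v\<bar> \<le> (a + b) * (8 * M ^ 3 + 24 * M * (1 + (3 * M)\<^sup>2)
    + 4 * M\<^sup>2 * (48 * M ^ 3 + 6 * M))"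
proof -
  define L E G where "L = 3 * M" and "E = 16 * L * M\<^sup>2 + 6 * M"
    and "G = 4 * L * (1 + L\<^sup>2) / (f \<alpha> - g \<alpha>)\<^sup>2"
  have M: "0 \<le> M" using bounds(1)[of 0] by linarith
  have f1: "\<bar>deriv f x\<bar> \<le> L" for x
    unfolding L_def using f bounds(1,3) by (rule abs_deriv_le)
  have g1: "\<bar>deriv g x\<bar> \<le> L" for x
    unfolding L_def using g bounds(2,4) by (rule abs_deriv_le)
  have cont: "isCont f x" "isCont (deriv f) x" "isCont g x" "isCont (deriv g) x" for x
    using f[THEN DERIV_isCont] g[THEN DERIV_isCont] by auto
  have G: "0 \<le> G" using M by (auto simp: G_def L_def)
  have E: "0 \<le> E" using M by (auto simp: E_def L_def)
  have u: "(f \<alpha> - g \<alpha>)\<^sup>2 \<le> 4 * M\<^sup>2" "0 < (f \<alpha> - g \<alpha>)\<^sup>2"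
  proof -
    have "\<bar>f \<alpha> - g \<alpha>\<bar> \<le> \<bar>2 * M\<bar>" using bounds(1,2)[of \<alpha>] M by linarith
    then show "(f \<alpha> - g \<alpha>)\<^sup>2 \<le> 4 * M\<^sup>2" using abs_le_square_iff[of "f \<alpha> - g \<alpha>" "2 * M"]
      by (simp add: power_mult_distrib)
  qed (use gap in simp)
  have v_le: "\<bar>v\<bar> \<le> a * (2 * M + E) + b * (2 * G + E)"
  proof (rule has_pv_integral_abs_le[OF v])
    fix \<epsilon> R :: real assume eR: "0 < \<epsilon>" "\<epsilon> < 1" "1 < R"
    let ?A = "{\<beta>. \<epsilon> < \<bar>\<beta>\<bar> \<and> \<bar>\<beta>\<bar> < R}"
    have int: "set_integrable lborel ?A (muskat_kernel f f \<alpha>)"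
        "set_integrable lborel ?A (muskat_kernel f g \<alpha>)"
      using eR by (auto intro!: set_integrable_annulus isCont_muskat_kernel cont)
    have 1: "\<bar>set_lebesgue_integral lborel ?A (muskat_kernel f f \<alpha>)\<bar> \<le> 2 * M + E"
      unfolding E_def using eR
      by (intro truncated_muskat_kernel_bound f cont bounds f1
          muskat_kernel_same_bound[OF f(2) bounds(3)]) auto
    have 2: "\<bar>set_lebesgue_integral lborel ?A (muskat_kernel f g \<alpha>)\<bar> \<le> 2 * G + E"
      unfolding E_def G_def using eR gap
      by (intro truncated_muskat_kernel_bound g cont bounds f1 g1 muskat_kernel_gap_bound) auto
    have "\<bar>set_lebesgue_integral lborel ?A (\<lambda>\<beta>. a * muskat_kernel f f \<alpha> \<beta> + b * muskat_kernel f g \<alpha> \<beta>)\<bar>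
      \<le> \<bar>a * set_lebesgue_integral lborel ?A (muskat_kernel f f \<alpha>)\<bar>
        + \<bar>b * set_lebesgue_integral lborel ?A (muskat_kernel f g \<alpha>)\<bar>"
      using int abs_triangle_ineq by (simp add: set_integral_add)
    also have "\<dots> \<le> a * (2 * M + E) + b * (2 * G + E)"
      using 1 2 ab by (intro add_mono) (auto simp: abs_mult intro: mult_left_mono)
    finally show "\<bar>set_lebesgue_integral lborel ?A
      (\<lambda>\<beta>. a * muskat_kernel f f \<alpha> \<beta> + b * muskat_kernel f g \<alpha> \<beta>)\<bar> \<le> \<dots>" .
  qed
  also have "\<dots> \<le> (a + b) * (2 * M + 2 * G + E)"
    using ab M G by (simp add: algebra_simps)
  finally have "(f \<alpha> - g \<alpha>)\<^sup>2 * \<bar>v\<bar> \<le> (f \<alpha> - g \<alpha>)\<^sup>2 * ((a + b) * (2 * M + 2 * G + E))"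
    by (rule mult_left_mono) simp
  also have "\<dots> = (a + b) * ((f \<alpha> - g \<alpha>)\<^sup>2 * (2 * M) + 2 * ((f \<alpha> - g \<alpha>)\<^sup>2 * G) + (f \<alpha> - g \<alpha>)\<^sup>2 * E)"
    by (simp add: algebra_simps)
  \<comment> \<open>The squared gap cancels exactly against the denominator in \<open>G\<close>;
    elsewhere it is estimated by \<open>4 * M\<^sup>2\<close>.\<close>
  also have "\<dots> \<le> (a + b) * (4 * M\<^sup>2 * (2 * M) + 2 * (4 * L * (1 + L\<^sup>2)) + 4 * M\<^sup>2 * E)"
    using u M E ab by (intro mult_left_mono add_mono mult_right_mono) (auto simp: G_def)
  also have "4 * M\<^sup>2 * (2 * M) + 2 * (4 * L * (1 + L\<^sup>2)) + 4 * M\<^sup>2 * E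
    = 8 * M ^ 3 + 24 * M * (1 + (3 * M)\<^sup>2) + 4 * M\<^sup>2 * (48 * M ^ 3 + 6 * M)"
    by (simp add: L_def E_def power3_eq_cube power2_eq_square)
  finally show ?thesis .
qed


section \<open>Sup norms, semicontinuity in time and integrability\<close>

text \<open>For continuous \<open>h\<close> the essential supremum is a true supremum: a superlevel
  set above it is open and null, hence empty. The bound \<open>K\<close> makes it finite, so that
  \<open>real_of_ereal\<close> does not send it to the default value 0.\<close>

lemma
  fixes h :: "real \<Rightarrow> real"
  assumes cont: "continuous_on UNIV h" and bound: "\<And>x. \<bar>h x\<bar> \<le> K"
  shows abs_le_Linf_norm: "\<bar>h x\<bar> \<le> Linf_norm h"
    and Linf_norm_le: "Linf_norm h \<le> K"
proof -
  let ?N = "esssup lborel (\<lambda>x. ereal \<bar>h x\<bar>)"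
  have "(\<lambda>x. \<bar>h x\<bar>) \<in> borel_measurable borel"
    by (intro borel_measurable_continuous_onI continuous_intros cont)
  then have "(\<lambda>x. ereal \<bar>h x\<bar>) \<in> borel_measurable lborel" by simp
  then have le: "?N \<le> ereal K"
    by (rule esssup_I) (simp add: bound)
  have ge: "ereal \<bar>h x\<bar> \<le> ?N" for x
  proof (rule ccontr)
    assume "\<not> ereal \<bar>h x\<bar> \<le> ?N"
    then obtain k where k: "?N < ereal k" "k < \<bar>h x\<bar>"
      using ereal_dense2[of ?N "ereal \<bar>h x\<bar>"] by (auto simp: not_le)
    let ?U = "{y. k < \<bar>h y\<bar>}"
    have U: "open ?U"
      by (intro open_Collect_less continuous_intros cont)
    have "AE y in lborel. y \<notin> ?U"
      using esssup_AE[of "\<lambda>x. ereal \<bar>h x\<bar>" lborel]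
    proof eventually_elim
      case (elim y)
      then have "ereal \<bar>h y\<bar> < ereal k" using k(1) by (rule le_less_trans)
      then show ?case by simp
    qed
    then have "?U \<in> null_sets lborel"
      using U by (subst (asm) AE_iff_null_sets[symmetric]) auto
    then have "negligible ?U"
      using negligible_iff_null_sets null_sets_completionI by blast
    then have "?U = {}"
      using U open_not_negligible by blast
    then show False using k by auto
  qed
  obtain n where n: "?N = ereal n"
    using le ge[of 0] by (cases ?N) auto
  show "\<bar>h x\<bar> \<le> Linf_norm h" "Linf_norm h \<le> K"
    using le ge[of x] by (simp_all add: Linf_norm_def n)
qed

text \<open>Lower semicontinuity of \<open>a\<close> at \<open>t\<close> within \<open>A\<close> is expressed as convergence of
  \<open>min (a s) (a t)\<close> to \<open>a t\<close>, which makes the limit theorems for sums and products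
  available.\<close>

definition lsc_within :: "real set \<Rightarrow> (real \<Rightarrow> real) \<Rightarrow> real \<Rightarrow> bool" where
  "lsc_within A a t \<longleftrightarrow> ((\<lambda>s. min (a s) (a t)) \<longlongrightarrow> a t) (at t within A)"

lemma lsc_within_iff:
  "lsc_within A a t \<longleftrightarrow> (\<forall>k<a t. \<forall>\<^sub>F s in at t within A. k < a s)"
proof
  assume "lsc_within A a t"
  then show "\<forall>k<a t. \<forall>\<^sub>F s in at t within A. k < a s"
    unfolding lsc_within_def order_tendsto_iff by (auto elim: eventually_mono)
next
  assume *: "\<forall>k<a t. \<forall>\<^sub>F s in at t within A. k < a s"
  show "lsc_within A a t"
    unfolding lsc_within_def
  proof (rule order_tendstoI)
    fix k assume "k < a t"
    with * show "\<forall>\<^sub>F s in at t within A. k < min (a s) (a t)"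
      by (auto elim: eventually_mono)
  qed (auto intro: always_eventually simp: min_less_iff_disj)
qed

lemma lsc_within_add:
  assumes "lsc_within A a t" "lsc_within A b t"
  shows "lsc_within A (\<lambda>s. a s + b s) t"
  unfolding lsc_within_def
proof (rule tendsto_sandwich)
  show "((\<lambda>s. min (a s) (a t) + min (b s) (b t)) \<longlongrightarrow> a t + b t) (at t within A)"
    using assms unfolding lsc_within_def by (rule tendsto_add)
  show "((\<lambda>s. a t + b t) \<longlongrightarrow> a t + b t) (at t within A)" by simp
qed (auto intro: always_eventually)

text \<open>Nonnegativity makes the product monotone in each truncated factor.\<close>

lemma lsc_within_mult:
  assumes "lsc_within A a t" "lsc_within A b t"
    and nonneg: "\<And>s. s \<in> A \<Longrightarrow> 0 \<le> a s" "\<And>s. s \<in> A \<Longrightarrow> 0 \<le> b s" and "t \<in> A"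
  shows "lsc_within A (\<lambda>s. a s * b s) t"
  unfolding lsc_within_def
proof (rule tendsto_sandwich)
  show "((\<lambda>s. min (a s) (a t) * min (b s) (b t)) \<longlongrightarrow> a t * b t) (at t within A)"
    using assms(1,2) unfolding lsc_within_def by (rule tendsto_mult)
  show "((\<lambda>s. a t * b t) \<longlongrightarrow> a t * b t) (at t within A)" by simp
  show "\<forall>\<^sub>F s in at t within A. min (a s) (a t) * min (b s) (b t) \<le> min (a s * b s) (a t * b t)"
    using nonneg \<open>t \<in> A\<close> by (auto simp: eventually_at_filter intro!: always_eventually mult_mono)
qed (auto intro: always_eventually)

lemma lsc_within_const: "lsc_within A (\<lambda>_. c) t"
  by (simp add: lsc_within_def)

text \<open>A supremum of functions continuous in time is lower semicontinuous: a position where the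
  modulus exceeds \<open>k\<close> at time \<open>t\<close> serves for nearby times too. Upper
  semicontinuity may fail, since positions range over a non-compact line.\<close>

lemma lsc_within_Linf_norm:
  fixes F :: "real \<Rightarrow> real \<Rightarrow> real"
  assumes "\<And>s. s \<in> A \<Longrightarrow> continuous_on UNIV (\<lambda>x. F x s)"
    and "\<And>x s. s \<in> A \<Longrightarrow> \<bar>F x s\<bar> \<le> K"
    and "\<And>x. continuous (at t within A) (F x)" and "t \<in> A"
  shows "lsc_within A (\<lambda>s. Linf_norm (\<lambda>x. F x s)) t"
  unfolding lsc_within_iff
proof (intro allI impI)
  fix k assume k: "k < Linf_norm (\<lambda>x. F x t)"
  have "\<exists>x. k < \<bar>F x t\<bar>"
    using k Linf_norm_le[OF assms(1)[OF \<open>t \<in> A\<close>], of k] by (meson linorder_not_less)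
  then obtain x where x: "k < \<bar>F x t\<bar>" ..
  have "((\<lambda>s. \<bar>F x s\<bar>) \<longlongrightarrow> \<bar>F x t\<bar>) (at t within A)"
    using assms(3)[of x] unfolding continuous_within by (rule tendsto_rabs)
  then have "\<forall>\<^sub>F s in at t within A. k < \<bar>F x s\<bar>"
    using x by (rule order_tendstoD)
  moreover have "\<forall>\<^sub>F s in at t within A. s \<in> A"
    by (simp add: eventually_at_filter)
  ultimately show "\<forall>\<^sub>F s in at t within A. k < Linf_norm (\<lambda>x. F x s)"
    by eventually_elim (use abs_le_Linf_norm assms(1,2) in \<open>blast intro: less_le_trans\<close>)
qed

text \<open>Superlevel sets are relatively open in \<open>{0..b}\<close>, which gives measurability;
  the bound then gives integrability.\<close>

lemma lsc_set_integrable: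
  fixes r :: "real \<Rightarrow> real"
  assumes lsc: "\<And>t. t \<in> {0..b} \<Longrightarrow> lsc_within {0..b} r t"
    and bound: "\<And>t. t \<in> {0..b} \<Longrightarrow> \<bar>r t\<bar> \<le> K"
  shows "set_integrable lborel {0..b} r"
proof -
  have "openin (top_of_set {0..b}) {t \<in> {0..b}. k < r t}" for k
    unfolding openin_contains_ball
  proof (intro conjI ballI)
    fix t assume t: "t \<in> {t \<in> {0..b}. k < r t}"
    then have "\<forall>\<^sub>F s in at t within {0..b}. k < r s"
      using lsc[of t] unfolding lsc_within_iff by blast
    then obtain d where "0 < d" "\<forall>s\<in>{0..b}. s \<noteq> t \<and> dist s t < d \<longrightarrow> k < r s"
      unfolding eventually_at by blast
    then show "\<exists>e>0. ball t e \<inter> {0..b} \<subseteq> {t \<in> {0..b}. k < r t}"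
      using t by (intro exI[of _ d]) (auto simp: dist_commute)
  qed auto
  then have borel: "{t \<in> {0..b}. k < r t} \<in> sets borel" for k
    unfolding openin_open by (metis borel_closed borel_open closed_atLeastAtMost sets.Int)
  have "(\<lambda>t. indicator {0..b} t *\<^sub>R r t) \<in> borel_measurable lborel"
    unfolding borel_measurable_iff_greater
  proof
    fix k
    have "{t \<in> space lborel. k < indicator {0..b} t *\<^sub>R r t}
      = {t \<in> {0..b}. k < r t} \<union> (if k < 0 then - {0..b} else {})"
      by (auto simp: indicator_def)
    then show "{t \<in> space lborel. k < indicator {0..b} t *\<^sub>R r t} \<in> sets lborel"
      using borel[of k] by auto
  qed
  moreover have "integrable lborel (\<lambda>t. indicator {0..b} t *\<^sub>R K)"
    unfolding set_integrable_def[symmetric]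
    by (intro borel_integrable_atLeastAtMost' continuous_intros)
  moreover have "norm (indicator {0..b} t *\<^sub>R r t) \<le> norm (indicator {0..b} t *\<^sub>R K)" for t
    using bound[of t] by (auto simp: indicator_def)
  ultimately show ?thesis
    unfolding set_integrable_def by (blast intro: Bochner_Integration.integrable_bound AE_I2)
qed

text \<open>This replaces differentiation of the time integral, which a merely semicontinuous
  integrand need not permit.\<close>

lemma set_integral_increment_ge:
  fixes r :: "real \<Rightarrow> real"
  assumes int: "set_integrable lborel {0..t} r" and "0 \<le> s" "s \<le> t"
    and c: "\<And>x. s < x \<Longrightarrow> x \<le> t \<Longrightarrow> c \<le> r x"
  shows "c * (t - s) \<le> set_lebesgue_integral lborel {0..t} r - set_lebesgue_integral lborel {0..s} r"
proof -
  have int': "set_integrable lborel {0..s} r" "set_integrable lborel {s<..t} r"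
    by (rule set_integrable_subset[OF int]; use assms in auto)+
  have "{0..t} = {0..s} \<union> {s<..t}" using assms by auto
  then have eq: "set_lebesgue_integral lborel {0..t} r
    = set_lebesgue_integral lborel {0..s} r + set_lebesgue_integral lborel {s<..t} r"
    using int' by (auto intro: set_integral_Un)
  have "set_integrable lborel {s..t} (\<lambda>_. c)"
    by (intro borel_integrable_atLeastAtMost' continuous_intros)
  then have "set_integrable lborel {s<..t} (\<lambda>_. c)"
    by (rule set_integrable_subset) auto
  then have "set_lebesgue_integral lborel {s<..t} (\<lambda>_. c) \<le> set_lebesgue_integral lborel {s<..t} r"
    using int' c by (intro set_integral_mono) auto
  moreover have "set_lebesgue_integral lborel {s<..t} (\<lambda>_. c) = c * (t - s)"
    using assms by (subst set_integral_const) auto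
  ultimately show ?thesis using eq by simp
qed

section \<open>A comparison argument for the double logarithm\<close>

text \<open>Take the infimum of the times in \<open>[0, b]\<close> at which \<open>\<Psi>\<close> exceeds a level above \<open>\<Psi> 0\<close>:
  the first hypothesis forbids that it is attained, the second that it is not.\<close>

lemma le_initial_if_left_witness:
  fixes \<Psi> :: "real \<Rightarrow> real"
  assumes "0 \<le> b"
    and left: "\<And>t. 0 < t \<Longrightarrow> t \<le> b \<Longrightarrow> \<exists>s. 0 \<le> s \<and> s < t \<and> \<Psi> t \<le> \<Psi> s"
    and right: "\<And>t k. 0 \<le> t \<Longrightarrow> t < b \<Longrightarrow> \<Psi> t < k \<Longrightarrow>
      \<exists>d>0. \<forall>s. t < s \<and> s < t + d \<and> s \<le> b \<longrightarrow> \<Psi> s < k"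
  shows "\<Psi> b \<le> \<Psi> 0"
proof (rule ccontr)
  assume "\<not> \<Psi> b \<le> \<Psi> 0"
  then obtain k where k: "\<Psi> 0 < k" "k < \<Psi> b" using dense[of "\<Psi> 0" "\<Psi> b"] by auto
  define E where "E = {t. 0 \<le> t \<and> t \<le> b \<and> k \<le> \<Psi> t}"
  have bE: "b \<in> E" using k \<open>0 \<le> b\<close> by (simp add: E_def)
  have bdd: "bdd_below E" by (auto simp: E_def bdd_below_def)
  define t where "t = Inf E"
  have t: "0 \<le> t" "t \<le> b"
    using bE bdd by (auto simp: t_def E_def intro!: cInf_greatest cInf_lower)
  show False
  proof (cases "k \<le> \<Psi> t")
    case True
    then have "0 < t" using k t by (cases "t = 0") auto
    then obtain s where s: "0 \<le> s" "s < t" "\<Psi> t \<le> \<Psi> s" using left t by blast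
    then have "s \<in> E" using True t by (simp add: E_def)
    then have "t \<le> s" unfolding t_def using bdd by (rule cInf_lower)
    with s show False by simp
  next
    case False
    then have "t \<noteq> b" using k by auto
    then obtain d where d: "0 < d" "\<And>s. t < s \<Longrightarrow> s < t + d \<Longrightarrow> s \<le> b \<Longrightarrow> \<Psi> s < k"
      using right[of t k] t False by auto
    have "t + d \<le> t"
      unfolding t_def[symmetric]
    proof (subst (2) t_def, rule cInf_greatest)
      fix s assume s: "s \<in> E"
      then have "t \<le> s" unfolding t_def using bdd by (intro cInf_lower)
      then show "t + d \<le> s"
        using s False d(2)[of s] by (cases "s = t") (fastforce simp: E_def not_less[symmetric])+
    qed (use bE in auto)
    then show False using d by simp
  qed
qed

text \<open>The double logarithm linearises the rate: for
  \<open>v' = - r * v t * (- ln (v t))\<close> the resulting derivative is exactly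
  \<open>r\<close>.\<close>

lemma DERIV_ln_minus_ln:
  assumes "(v has_real_derivative v') (at t within A)" "0 < v t" "v t < 1"
  shows "((\<lambda>s. ln (- ln (v s))) has_real_derivative - v' / (v t * (- ln (v t)))) (at t within A)"
proof -
  have "ln (v t) < 0" using assms by simp
  then show ?thesis
    using assms by (auto intro!: derivative_eq_intros simp: field_simps)
qed

text \<open>The bound by \<open>B\<close> makes \<open>S t ^ 3 + 3 * B * t\<close> nondecreasing, so that \<open>S\<close> cannot jump
  downwards. Without it the minimum could drop instantaneously, by a trough entering from
  infinity, although every minimum point obeys the rate inequality.\<close>

lemma log_log_gronwall:
  fixes u ut :: "real \<Rightarrow> real \<Rightarrow> real" and S r :: "real \<Rightarrow> real"
  assumes b: "0 \<le> b"
    and min: "\<And>t. t \<in> {0..b} \<Longrightarrow> is_minimum_of (S t) (\<lambda>\<alpha>. u \<alpha> t)"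
    and S: "\<And>t. t \<in> {0..b} \<Longrightarrow> 0 < S t" "\<And>t. t \<in> {0..b} \<Longrightarrow> S t < 1"
    and der: "\<And>\<alpha> t. t \<in> {0..b} \<Longrightarrow> (u \<alpha> has_real_derivative ut \<alpha> t) (at t within {0..b})"
    and B: "\<And>\<alpha> t. t \<in> {0..b} \<Longrightarrow> (u \<alpha> t)\<^sup>2 * \<bar>ut \<alpha> t\<bar> \<le> B"
    and rate: "\<And>\<alpha> t. t \<in> {0..b} \<Longrightarrow> u \<alpha> t = S t \<Longrightarrow> - (r t * (S t * (- ln (S t)))) \<le> ut \<alpha> t"
    and lsc: "\<And>t. t \<in> {0..b} \<Longrightarrow> lsc_within {0..b} r t"
    and r: "\<And>t. t \<in> {0..b} \<Longrightarrow> 0 \<le> r t" "\<And>t. t \<in> {0..b} \<Longrightarrow> r t \<le> K"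
  shows "exp (ln (S 0) * exp (set_lebesgue_integral lborel {0..b} r)) \<le> S b"
proof -
  define I where "I t = set_lebesgue_integral lborel {0..t} r" for t
  define Y where "Y t = ln (- ln (S t))" for t
  have lnS: "ln (S t) < 0" if "t \<in> {0..b}" for t using S that by simp
  have Sle: "S t \<le> u \<alpha> t" if "t \<in> {0..b}" for \<alpha> t
    using min[OF that] by (auto simp: is_minimum_of_def)
  have int: "set_integrable lborel {0..t} r" if "t \<le> b" for t
    using lsc_set_integrable[of b r K] lsc r that
    by (auto intro: set_integrable_subset[of lborel "{0..b}"])
  have I_mono: "I s \<le> I t" if "0 \<le> s" "s \<le> t" "t \<le> b" for s t
    using set_integral_increment_ge[OF int, of t s 0] that r by (auto simp: I_def)
  have I_0: "I 0 = 0"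
    by (simp add: I_def set_integral_at_point)
  have B0: "0 \<le> B" using B[of 0 0] b by (auto intro: order_trans[rotated])
  have cube: "S s ^ 3 - 3 * B * (t - s) \<le> S t ^ 3" if st: "0 \<le> s" "s < t" "t \<le> b" for s t
  proof -
    \<comment> \<open>The minimum point belongs to the later time \<open>t\<close>, so
      \<open>u \<alpha>\<close> equals \<open>S\<close> at \<open>t\<close> and dominates it at
      \<open>s\<close>.\<close>
    obtain \<alpha> where \<alpha>: "u \<alpha> t = S t" using min[of t] st by (auto simp: is_minimum_of_def)
    have "\<exists>x\<in>{s<..<t}. (u \<alpha> t) ^ 3 - (u \<alpha> s) ^ 3 = (t - s) *\<^sub>R (3 * (u \<alpha> x)\<^sup>2 * ut \<alpha> x)"
    proof (rule mvt_simple)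
      fix x assume x: "s \<le> x" "x \<le> t"
      have "(u \<alpha> has_real_derivative ut \<alpha> x) (at x within {s..t})"
        using der[of x \<alpha>] x st by (auto intro: DERIV_subset)
      then show "((\<lambda>x. u \<alpha> x ^ 3) has_derivative (\<lambda>h. h *\<^sub>R (3 * (u \<alpha> x)\<^sup>2 * ut \<alpha> x))) (at x within {s..t})"
        by (auto intro!: derivative_eq_intros simp: has_field_derivative_def)
    qed (use st in auto)
    then obtain x where x: "x \<in> {s<..<t}"
      "S t ^ 3 - (u \<alpha> s) ^ 3 = (t - s) * (3 * ((u \<alpha> x)\<^sup>2 * ut \<alpha> x))"
      using \<alpha> by (auto simp: mult_ac)
    have "\<bar>(u \<alpha> x)\<^sup>2 * ut \<alpha> x\<bar> \<le> B"
      using B[of x \<alpha>] x st by (simp add: abs_mult)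
    then have "(t - s) * (3 * - B) \<le> (t - s) * (3 * ((u \<alpha> x)\<^sup>2 * ut \<alpha> x))"
      using st by (intro mult_left_mono) auto
    moreover have "S s ^ 3 \<le> (u \<alpha> s) ^ 3"
      using S(1)[of s] Sle[of s \<alpha>] st by (intro power_mono) auto
    ultimately show ?thesis using x(2) by (simp add: algebra_simps)
  qed
  \<comment> \<open>One half of the slack \<open>e\<close> pays for the difference quotient of
    \<open>y\<close>, the other for the lower semicontinuity of \<open>r\<close>.\<close>
  have main: "Y b - I b - e * b \<le> Y 0 - I 0 - e * 0" if e: "0 < e" for e
  proof (rule le_initial_if_left_witness[where \<Psi> = "\<lambda>t. Y t - I t - e * t", OF b])
    fix t assume t: "0 < t" "t \<le> b"
    obtain \<alpha> where \<alpha>: "u \<alpha> t = S t" using min[of t] t by (auto simp: is_minimum_of_def)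
    define y where "y s = ln (- ln (u \<alpha> s))" for s
    define y' where "y' = - ut \<alpha> t / (S t * (- ln (S t)))"
    have tb: "t \<in> {0..b}" using t by simp
    have sub: "{0..<t} \<subseteq> {0..b}" using t by auto
    have du: "(u \<alpha> has_real_derivative ut \<alpha> t) (at t within {0..<t})"
      using der[OF tb] sub by (rule DERIV_subset)
    have pos: "0 < S t * (- ln (S t))" using S lnS tb by (simp add: mult_pos_neg)
    have "- ut \<alpha> t \<le> r t * (S t * (- ln (S t)))" using rate[OF tb \<alpha>] by linarith
    then have y'_le: "y' \<le> r t" unfolding y'_def using pos by (simp only: pos_divide_le_eq)
    have "(y has_real_derivative y') (at t within {0..<t})"
      unfolding y_def y'_def using DERIV_ln_minus_ln[OF du] \<alpha> S tb by auto
    then have "((\<lambda>s. (y s - y t) / (s - t)) \<longlongrightarrow> y') (at t within {0..<t})"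
      by (simp add: has_field_derivative_iff)
    then have 1: "\<forall>\<^sub>F s in at t within {0..<t}. (y s - y t) / (s - t) < y' + e / 2"
      using e by (intro order_tendstoD(2)) auto
    have "(u \<alpha> \<longlongrightarrow> u \<alpha> t) (at t within {0..<t})"
      using du by (auto dest: DERIV_continuous simp: continuous_within)
    then have 2: "\<forall>\<^sub>F s in at t within {0..<t}. u \<alpha> s < 1"
      using S(2)[OF tb] \<alpha> by (intro order_tendstoD(2)) auto
    have "\<forall>\<^sub>F s in at t within {0..b}. r t - e / 2 < r s"
      using lsc[OF tb] e unfolding lsc_within_iff by auto
    then obtain d where d: "0 < d"
      "\<And>s. s \<in> {0..b} \<Longrightarrow> s \<noteq> t \<Longrightarrow> dist s t < d \<Longrightarrow> r t - e / 2 < r s"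
      unfolding eventually_at by blast
    have 3: "\<forall>\<^sub>F s in at t within {0..<t}. s \<in> {0..<t} \<and> dist s t < d"
      using d(1) unfolding eventually_at by blast
    have "at t within {0..<t} \<noteq> bot"
      using t by (simp add: at_within_eq_bot_iff islimpt_in_closure)
    then obtain s where s: "(y s - y t) / (s - t) < y' + e / 2" "u \<alpha> s < 1" "s \<in> {0..<t}" "dist s t < d"
      using eventually_happens'[OF _ eventually_conj[OF 1 eventually_conj[OF 2 3]]] by auto
    have sb: "s \<in> {0..b}" using s sub by blast
    have "y t - y s = (t - s) * ((y s - y t) / (s - t))"
      using s by (simp add: field_simps)
    also have "\<dots> \<le> (t - s) * (r t + e / 2)"
      using s y'_le by (intro mult_left_mono) auto
    finally have y: "y t - y s \<le> (t - s) * (r t + e / 2)" .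
    have "Y t = y t" by (simp add: Y_def y_def \<alpha>)
    \<comment> \<open>The map \<open>ln (- ln x)\<close> is decreasing between 0 and 1, and
      \<open>S s \<le> u \<alpha> s < 1\<close>.\<close>
    moreover have "y s \<le> Y s"
    proof -
      have "0 < u \<alpha> s" using Sle[OF sb, of \<alpha>] S(1)[OF sb] by linarith
      then have "ln (S s) \<le> ln (u \<alpha> s)" "ln (u \<alpha> s) < 0"
        using Sle[OF sb, of \<alpha>] S(1)[OF sb] s(2) by auto
      then show ?thesis by (simp add: y_def Y_def)
    qed
    moreover have "(r t - e / 2) * (t - s) \<le> I t - I s"
      unfolding I_def
    proof (rule set_integral_increment_ge[OF int])
      fix x assume x: "s < x" "x \<le> t"
      then show "r t - e / 2 \<le> r x"
        using d(2)[of x] s t e by (cases "x = t") (auto simp: dist_real_def)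
    qed (use t s in auto)
    moreover have "(t - s) * (r t + e / 2) = (r t - e / 2) * (t - s) + (e * t - e * s)"
      by (simp add: algebra_simps)
    ultimately have "Y t - I t - e * t \<le> Y s - I s - e * s"
      using y by linarith
    then show "\<exists>s\<ge>0. s < t \<and> Y t - I t - e * t \<le> Y s - I s - e * s"
      using s by auto
  next
    fix t k assume t: "0 \<le> t" "t < b" and k: "Y t - I t - e * t < k"
    \<comment> \<open>At height \<open>\<sigma>\<close> the double logarithm equals
      \<open>k + I t + e * t\<close>, so an upper bound for \<open>Y\<close> becomes a lower bound
      for \<open>S\<close>. The subtracted terms \<open>I s\<close> and \<open>e * s\<close> do not
      decrease after \<open>t\<close>.\<close>
    define \<sigma> where "\<sigma> = exp (- exp (k + I t + e * t))"
    have tb: "t \<in> {0..b}" using t by simp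
    have Y_less: "Y s < k + I t + e * t \<longleftrightarrow> \<sigma> < S s" if "s \<in> {0..b}" for s
    proof -
      have "Y s < k + I t + e * t \<longleftrightarrow> - ln (S s) < exp (k + I t + e * t)"
        unfolding Y_def using lnS[OF that] by (metis exp_less_cancel_iff exp_ln neg_0_less_iff_less)
      also have "\<dots> \<longleftrightarrow> ln \<sigma> < ln (S s)" by (auto simp: \<sigma>_def)
      also have "\<dots> \<longleftrightarrow> \<sigma> < S s" using S(1)[OF that] by (intro ln_less_cancel_iff) (auto simp: \<sigma>_def)
      finally show ?thesis .
    qed
    have "\<sigma> < S t" using Y_less[OF tb] k by simp
    then have gap: "\<sigma> ^ 3 < S t ^ 3" by (intro power_strict_mono) (auto simp: \<sigma>_def)
    \<comment> \<open>Before time \<open>t + d\<close> the cube of \<open>S\<close> falls by less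
      than \<open>S t ^ 3 - \<sigma> ^ 3\<close>. The summand 1 in the denominator covers
      \<open>B = 0\<close>.\<close>
    define d where "d = (S t ^ 3 - \<sigma> ^ 3) / (3 * B + 1)"
    have "0 < d" using gap B0 by (simp add: d_def)
    moreover have "Y s - I s - e * s < k" if s: "t < s" "s < t + d" "s \<le> b" for s
    proof -
      have "(3 * B + 1) * (s - t) < (3 * B + 1) * d"
        using s B0 by (intro mult_strict_left_mono) auto
      also have "\<dots> = S t ^ 3 - \<sigma> ^ 3" using B0 by (simp add: d_def)
      finally have "\<sigma> ^ 3 < S t ^ 3 - 3 * B * (s - t)" using s by (simp add: algebra_simps)
      also have "\<dots> \<le> S s ^ 3" using cube[of t s] t s by simp
      finally have "\<sigma> < S s"
        using power_less_imp_less_base[of \<sigma> 3 "S s"] S(1)[of s] t s by simp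
      then have "Y s < k + I t + e * t" using Y_less[of s] t s by simp
      moreover have "I t \<le> I s" using I_mono t s by simp
      moreover have "e * t \<le> e * s" using e s by simp
      ultimately show ?thesis by linarith
    qed
    ultimately show "\<exists>d>0. \<forall>s. t < s \<and> s < t + d \<and> s \<le> b \<longrightarrow> Y s - I s - e * s < k"
      by blast
  qed
  have "Y b - I b \<le> Y 0"
  proof (rule field_le_epsilon)
    fix e :: real assume "0 < e"
    \<comment> \<open>Division by \<open>b + 1\<close> instead of \<open>b\<close> admits
      \<open>b = 0\<close>.\<close>
    then have "Y b - I b - e / (b + 1) * b \<le> Y 0" using main[of "e / (b + 1)"] b I_0 by simp
    moreover have "e / (b + 1) * b \<le> e" using b \<open>0 < e\<close> by (simp add: field_simps)
    ultimately show "Y b - I b \<le> Y 0 + e" by linarith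
  qed
  then have "exp (Y b) \<le> exp (Y 0 + I b)" by simp
  then have "- ln (S b) \<le> - ln (S 0) * exp (I b)"
    using lnS[of b] lnS[of 0] b by (simp add: Y_def exp_add)
  then have "exp (ln (S 0) * exp (I b)) \<le> exp (ln (S b))" by simp
  then show ?thesis using S(1)[of b] b by (simp add: I_def)
qed


section \<open>Application to the Muskat system\<close>

lemma DERIV_zero_at_minimum:
  fixes h :: "real \<Rightarrow> real"
  assumes "(h has_real_derivative d) (at x)" "\<And>y. h x \<le> h y"
  shows "d = 0"
  using DERIV_local_min[OF assms(1), of 1] assms(2) by auto

text \<open>Uniform bounds are available on compact time intervals \<open>{0..b}\<close>. The second
  derivative appears as one function \<open>f2\<close> of both variables, because semicontinuity of
  its norm needs continuity in time at a fixed position.\<close>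

lemma smooth_free_boundaryE:
  assumes "smooth_free_boundary T f" "b \<in> {0..<T}"
  obtains f2 M where
    "\<And>x t. t \<in> {0..b} \<Longrightarrow> ((\<lambda>x. f x t) has_real_derivative deriv (\<lambda>x. f x t) x) (at x)"
    "\<And>x t. t \<in> {0..b} \<Longrightarrow> (deriv (\<lambda>x. f x t) has_real_derivative f2 x t) (at x)"
    "\<And>t. t \<in> {0..b} \<Longrightarrow> (deriv ^^ 2) (\<lambda>x. f x t) = (\<lambda>x. f2 x t)"
    "\<And>t. t \<in> {0..b} \<Longrightarrow> continuous_on UNIV (\<lambda>x. f2 x t)"
    "\<And>x t. t \<in> {0..b} \<Longrightarrow> continuous (at t within {0..b}) (f2 x)"
    "\<And>x t. t \<in> {0..b} \<Longrightarrow> \<bar>f x t\<bar> \<le> M"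
    "\<And>x t. t \<in> {0..b} \<Longrightarrow> \<bar>f2 x t\<bar> \<le> M"
proof -
  obtain F where F: "\<And>\<alpha> t. t \<in> {0..<T} \<Longrightarrow> F 0 0 \<alpha> t = f \<alpha> t"
    "\<And>j k \<alpha> t. t \<in> {0..<T} \<Longrightarrow> ((\<lambda>x. F j k x t) has_real_derivative F (Suc j) k \<alpha> t) (at \<alpha>)"
    "\<And>j k \<alpha> t. t \<in> {0..<T} \<Longrightarrow>
      (F j k \<alpha> has_real_derivative F j (Suc k) \<alpha> t) (at t within {0..<T})"
    using assms(1) unfolding smooth_free_boundary_def smooth_on_strip_def by blast
  obtain M where M: "\<And>\<alpha> t. t \<in> {0..b} \<Longrightarrow> \<bar>f \<alpha> t\<bar> \<le> M"
      "\<And>\<alpha> t. t \<in> {0..b} \<Longrightarrow> \<bar>(deriv ^^ 2) (\<lambda>x. f x t) \<alpha>\<bar> \<le> M"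
    using assms unfolding smooth_free_boundary_def by blast
  have sub: "{0..b} \<subseteq> {0..<T}" using assms(2) by auto
  have d1: "deriv (\<lambda>x. f x t) = (\<lambda>x. F 1 0 x t)"
    and D1: "((\<lambda>x. f x t) has_real_derivative F 1 0 x t) (at x)" if "t \<in> {0..b}" for t x
  proof -
    have t: "t \<in> {0..<T}" using sub that by blast
    show *: "((\<lambda>x. f x t) has_real_derivative F 1 0 x t) (at x)" for x
      using F(2)[OF t, of 0 0 x] F(1)[OF t] by simp
    show "deriv (\<lambda>x. f x t) = (\<lambda>x. F 1 0 x t)"
      using DERIV_imp_deriv[OF *] by auto
  qed
  have D2: "((\<lambda>x. F 1 0 x t) has_real_derivative F 2 0 x t) (at x)" if "t \<in> {0..b}" for t x
    using F(2)[of t 1 0 x] sub that by (auto simp: numeral_2_eq_2)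
  have d2: "(deriv ^^ 2) (\<lambda>x. f x t) = (\<lambda>x. F 2 0 x t)" if "t \<in> {0..b}" for t
    using DERIV_imp_deriv[OF D2[OF that]] by (auto simp: numeral_2_eq_2 d1[OF that])
  show thesis
  proof
    show "continuous_on UNIV (\<lambda>x. F 2 0 x t)" if "t \<in> {0..b}" for t
      using F(2)[of t 2 0] sub that
      by (intro continuous_at_imp_continuous_on ballI) (blast intro: DERIV_isCont)
    show "continuous (at t within {0..b}) (F 2 0 x)" if "t \<in> {0..b}" for x t
      using F(3)[of t 2 0 x] sub that by (blast intro: DERIV_continuous DERIV_subset)
  qed (use M D1 D2 d1 d2 in auto)
qed

text \<open>These are the hypotheses on \<open>r\<close> in \<open>log_log_gronwall\<close>. Each
  norm is lower semicontinuous and bounded on \<open>{0..b}\<close>, and sums and nonnegative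
  products preserve both properties.\<close>

lemma
  assumes f: "smooth_free_boundary T f" and g: "smooth_free_boundary T g"
    and fd: "\<And>\<alpha>. continuous_on {0..b} (f \<alpha>)" and gd: "\<And>\<alpha>. continuous_on {0..b} (g \<alpha>)"
    and b: "b \<in> {0..<T}" and C: "0 \<le> C"
  shows lsc_within_muskat_rate: "\<And>t. t \<in> {0..b} \<Longrightarrow> lsc_within {0..b} (muskat_rate C f g) t"
    and muskat_rate_nonneg: "\<And>t. t \<in> {0..b} \<Longrightarrow> 0 \<le> muskat_rate C f g t"
    and muskat_rate_bounded: "\<exists>K. \<forall>t\<in>{0..b}. muskat_rate C f g t \<le> K"
proof -
  obtain f2 M where f:
    "\<And>x t. t \<in> {0..b} \<Longrightarrow> ((\<lambda>x. f x t) has_real_derivative deriv (\<lambda>x. f x t) x) (at x)"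
    "\<And>t. t \<in> {0..b} \<Longrightarrow> (deriv ^^ 2) (\<lambda>x. f x t) = (\<lambda>x. f2 x t)"
    "\<And>t. t \<in> {0..b} \<Longrightarrow> continuous_on UNIV (\<lambda>x. f2 x t)"
    "\<And>x t. t \<in> {0..b} \<Longrightarrow> continuous (at t within {0..b}) (f2 x)"
    "\<And>x t. t \<in> {0..b} \<Longrightarrow> \<bar>f x t\<bar> \<le> M"
    "\<And>x t. t \<in> {0..b} \<Longrightarrow> \<bar>f2 x t\<bar> \<le> M"
    by (rule smooth_free_boundaryE[OF f b]) blast
  obtain g2 N where g:
    "\<And>x t. t \<in> {0..b} \<Longrightarrow> ((\<lambda>x. g x t) has_real_derivative deriv (\<lambda>x. g x t) x) (at x)"
    "\<And>t. t \<in> {0..b} \<Longrightarrow> (deriv ^^ 2) (\<lambda>x. g x t) = (\<lambda>x. g2 x t)"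
    "\<And>t. t \<in> {0..b} \<Longrightarrow> continuous_on UNIV (\<lambda>x. g2 x t)"
    "\<And>x t. t \<in> {0..b} \<Longrightarrow> continuous (at t within {0..b}) (g2 x)"
    "\<And>x t. t \<in> {0..b} \<Longrightarrow> \<bar>g x t\<bar> \<le> N"
    "\<And>x t. t \<in> {0..b} \<Longrightarrow> \<bar>g2 x t\<bar> \<le> N"
    by (rule smooth_free_boundaryE[OF g b]) blast
  have cf: "continuous_on UNIV (\<lambda>x. f x t)" and cg: "continuous_on UNIV (\<lambda>x. g x t)"
    if "t \<in> {0..b}" for t
    using f(1)[OF that] g(1)[OF that]
    by (auto intro!: continuous_at_imp_continuous_on intro: DERIV_isCont)
  define A where "A t = Linf_norm (\<lambda>x. f2 x t) + Linf_norm (\<lambda>x. g2 x t)" for t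
  define B where "B t = Linf_norm (\<lambda>x. f x t) + Linf_norm (\<lambda>x. g x t) + 1" for t
  have eq: "muskat_rate C f g t = C * A t * B t" if "t \<in> {0..b}" for t
    using f(2)[OF that] g(2)[OF that] by (simp add: muskat_rate_def A_def B_def)
  have ge: "0 \<le> A t" "0 \<le> B t" if t: "t \<in> {0..b}" for t
    using order_trans[OF abs_ge_zero abs_le_Linf_norm[OF f(3)[OF t] f(6)[OF t]]]
      order_trans[OF abs_ge_zero abs_le_Linf_norm[OF g(3)[OF t] g(6)[OF t]]]
      order_trans[OF abs_ge_zero abs_le_Linf_norm[OF cf[OF t] f(5)[OF t]]]
      order_trans[OF abs_ge_zero abs_le_Linf_norm[OF cg[OF t] g(5)[OF t]]]
    by (auto simp: A_def B_def)
  have le: "A t \<le> M + N" "B t \<le> M + N + 1" if t: "t \<in> {0..b}" for t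
    using Linf_norm_le[OF f(3)[OF t] f(6)[OF t]] Linf_norm_le[OF g(3)[OF t] g(6)[OF t]]
      Linf_norm_le[OF cf[OF t] f(5)[OF t]] Linf_norm_le[OF cg[OF t] g(5)[OF t]]
    by (auto simp: A_def B_def)
  show nonneg: "0 \<le> muskat_rate C f g t" if t: "t \<in> {0..b}" for t
    using eq[OF t] ge[OF t] C by simp
  have "muskat_rate C f g t \<le> C * (M + N) * (M + N + 1)" if t: "t \<in> {0..b}" for t
    unfolding eq[OF t] using ge[OF t] le[OF t] C by (intro mult_mono) auto
  then show "\<exists>K. \<forall>t\<in>{0..b}. muskat_rate C f g t \<le> K" by blast
  show "lsc_within {0..b} (muskat_rate C f g) t" if t: "t \<in> {0..b}" for t
  proof -
    have "lsc_within {0..b} A t"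
      unfolding A_def
      by (intro lsc_within_add lsc_within_Linf_norm[of _ _ M] lsc_within_Linf_norm[of _ _ N])
        (use f g t in auto)
    moreover have "lsc_within {0..b} B t"
      unfolding B_def
      by (intro lsc_within_add lsc_within_const
          lsc_within_Linf_norm[of _ _ M] lsc_within_Linf_norm[of _ _ N])
        (use f g cf cg t fd gd in \<open>auto simp: continuous_on_eq_continuous_within\<close>)
    ultimately have "lsc_within {0..b} (\<lambda>t. C * A t * B t) t"
      using ge C t by (intro lsc_within_mult lsc_within_const) auto
    then show ?thesis
      unfolding lsc_within_iff eq[OF t]
      by (auto simp: eventually_at_filter eq elim!: eventually_mono)
  qed
qed

text \<open>With the time \<open>b\<close> fixed, all bounds are uniform on \<open>{0..b}\<close>
  and the comparison argument applies. The constant is explicit and involves only the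
  densities.\<close>

lemma muskat_minimum_lower_bound:
  fixes f g :: "real \<Rightarrow> real \<Rightarrow> real"
  assumes \<zeta>: "\<zeta>1 < \<zeta>2" "\<zeta>2 < \<zeta>3"
    and f: "smooth_free_boundary T f" and g: "smooth_free_boundary T g"
    and order: "\<And>\<alpha> t. t \<in> {0..<T} \<Longrightarrow> g \<alpha> t < f \<alpha> t"
    and sol: "muskat_solution \<zeta>1 \<zeta>2 \<zeta>3 T f g"
    and min: "\<And>t. t \<in> {0..<T} \<Longrightarrow> is_minimum_of (S t) (\<lambda>\<alpha>. f \<alpha> t - g \<alpha> t)"
    and S: "\<And>t. t \<in> {0..<T} \<Longrightarrow> 0 < S t" "\<And>t. t \<in> {0..<T} \<Longrightarrow> S t \<le> exp (- 1)"
    and b: "b \<in> {0..<T}"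
  shows "exp (ln (S 0) * exp (set_lebesgue_integral lborel {0..b}
      (muskat_rate (8 * ((\<zeta>2 - \<zeta>1) / (2 * pi) + (\<zeta>3 - \<zeta>2) / (2 * pi))) f g))) \<le> S b"
proof -
  define z1 z2 where "z1 = (\<zeta>2 - \<zeta>1) / (2 * pi)" and "z2 = (\<zeta>3 - \<zeta>2) / (2 * pi)"
  have z: "0 \<le> z1" "0 \<le> z2" using \<zeta> by (auto simp: z1_def z2_def)
  define C where "C = 8 * (z1 + z2)"
  have C: "0 \<le> C" using z by (simp add: C_def)
  have sub: "{0..b} \<subseteq> {0..<T}" using b by auto
  obtain f2 Mf where F:
    "\<And>x t. t \<in> {0..b} \<Longrightarrow> ((\<lambda>x. f x t) has_real_derivative deriv (\<lambda>x. f x t) x) (at x)"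
    "\<And>x t. t \<in> {0..b} \<Longrightarrow> (deriv (\<lambda>x. f x t) has_real_derivative f2 x t) (at x)"
    "\<And>t. t \<in> {0..b} \<Longrightarrow> (deriv ^^ 2) (\<lambda>x. f x t) = (\<lambda>x. f2 x t)"
    "\<And>t. t \<in> {0..b} \<Longrightarrow> continuous_on UNIV (\<lambda>x. f2 x t)"
    "\<And>x t. t \<in> {0..b} \<Longrightarrow> \<bar>f x t\<bar> \<le> Mf"
    "\<And>x t. t \<in> {0..b} \<Longrightarrow> \<bar>f2 x t\<bar> \<le> Mf"
    by (rule smooth_free_boundaryE[OF f b]) blast
  obtain g2 Mg where G:
    "\<And>x t. t \<in> {0..b} \<Longrightarrow> ((\<lambda>x. g x t) has_real_derivative deriv (\<lambda>x. g x t) x) (at x)"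
    "\<And>x t. t \<in> {0..b} \<Longrightarrow> (deriv (\<lambda>x. g x t) has_real_derivative g2 x t) (at x)"
    "\<And>t. t \<in> {0..b} \<Longrightarrow> (deriv ^^ 2) (\<lambda>x. g x t) = (\<lambda>x. g2 x t)"
    "\<And>t. t \<in> {0..b} \<Longrightarrow> continuous_on UNIV (\<lambda>x. g2 x t)"
    "\<And>x t. t \<in> {0..b} \<Longrightarrow> \<bar>g x t\<bar> \<le> Mg"
    "\<And>x t. t \<in> {0..b} \<Longrightarrow> \<bar>g2 x t\<bar> \<le> Mg"
    by (rule smooth_free_boundaryE[OF g b]) blast
  \<comment> \<open>At each point separately, \<open>muskat_solution\<close> provides a number that
    is both the time derivative and the principal value. The predicates serve to choose such numbers
    as functions \<open>v\<close> and \<open>w\<close>.\<close>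
  define Pv where "Pv \<alpha> t x \<longleftrightarrow> (f \<alpha> has_real_derivative x) (at t within {0..<T})
    \<and> has_pv_integral (\<lambda>\<beta>. z1 * muskat_kernel (\<lambda>x. f x t) (\<lambda>x. f x t) \<alpha> \<beta>
        + z2 * muskat_kernel (\<lambda>x. f x t) (\<lambda>x. g x t) \<alpha> \<beta>) x" for \<alpha> t x
  define Pw where "Pw \<alpha> t x \<longleftrightarrow> (g \<alpha> has_real_derivative x) (at t within {0..<T})
    \<and> has_pv_integral (\<lambda>\<beta>. z2 * muskat_kernel (\<lambda>x. g x t) (\<lambda>x. g x t) \<alpha> \<beta>
        + z1 * muskat_kernel (\<lambda>x. g x t) (\<lambda>x. f x t) \<alpha> \<beta>) x" for \<alpha> t x
  define v w where "v \<alpha> t = (SOME x. Pv \<alpha> t x)" and "w \<alpha> t = (SOME x. Pw \<alpha> t x)" for \<alpha> t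
  have Pvw: "Pv \<alpha> t (v \<alpha> t)" "Pw \<alpha> t (w \<alpha> t)" if "t \<in> {0..b}" for \<alpha> t
  proof -
    have "t \<in> {0..<T}" using sub that by blast
    then have "(\<exists>x. Pv \<alpha> t x) \<and> (\<exists>x. Pw \<alpha> t x)"
      using sol unfolding muskat_solution_def Let_def z1_def[symmetric] z2_def[symmetric]
        Pv_def Pw_def by blast
    then show "Pv \<alpha> t (v \<alpha> t)" "Pw \<alpha> t (w \<alpha> t)"
      unfolding v_def w_def by (auto intro: someI_ex)
  qed
  have v: "(f \<alpha> has_real_derivative v \<alpha> t) (at t within {0..b})"
    and w: "(g \<alpha> has_real_derivative w \<alpha> t) (at t within {0..b})"
    and pv: "has_pv_integral (\<lambda>\<beta>. z1 * muskat_kernel (\<lambda>x. f x t) (\<lambda>x. f x t) \<alpha> \<beta>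
        + z2 * muskat_kernel (\<lambda>x. f x t) (\<lambda>x. g x t) \<alpha> \<beta>) (v \<alpha> t)"
    and pw: "has_pv_integral (\<lambda>\<beta>. z2 * muskat_kernel (\<lambda>x. g x t) (\<lambda>x. g x t) \<alpha> \<beta>
        + z1 * muskat_kernel (\<lambda>x. g x t) (\<lambda>x. f x t) \<alpha> \<beta>) (w \<alpha> t)" if "t \<in> {0..b}" for \<alpha> t
    using Pvw[OF that, of \<alpha>] unfolding Pv_def Pw_def by (auto intro: DERIV_subset[OF _ sub])
  have cont: "continuous_on {0..b} (f \<alpha>)" "continuous_on {0..b} (g \<alpha>)" for \<alpha>
    using v w by (blast intro: DERIV_continuous_on)+
  note rate = lsc_within_muskat_rate[OF f g cont b C] muskat_rate_nonneg[OF f g cont b C]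
  obtain K where K: "\<And>t. t \<in> {0..b} \<Longrightarrow> muskat_rate C f g t \<le> K"
    using muskat_rate_bounded[OF f g cont b C] by blast
  define M where "M = max Mf Mg"
  define D where "D = (z1 + z2) * (8 * M ^ 3 + 24 * M * (1 + (3 * M)\<^sup>2)
    + 4 * M\<^sup>2 * (48 * M ^ 3 + 6 * M))"
  have bound: "\<bar>f x t\<bar> \<le> M" "\<bar>g x t\<bar> \<le> M" "\<bar>f2 x t\<bar> \<le> M" "\<bar>g2 x t\<bar> \<le> M" if "t \<in> {0..b}" for x t
    using F(5,6)[OF that, of x] G(5,6)[OF that, of x] by (auto simp: M_def)
  have "exp (ln (S 0) * exp (set_lebesgue_integral lborel {0..b} (muskat_rate C f g))) \<le> S b"
  proof (rule log_log_gronwall[where u = "\<lambda>\<alpha> t. f \<alpha> t - g \<alpha> t" and ut = "\<lambda>\<alpha> t. v \<alpha> t - w \<alpha> t"])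
    fix \<alpha> t assume t: "t \<in> {0..b}"
    then have tT: "t \<in> {0..<T}" using sub by blast
    show "((\<lambda>t. f \<alpha> t - g \<alpha> t) has_real_derivative v \<alpha> t - w \<alpha> t) (at t within {0..b})"
      using v[OF t] w[OF t] by (rule DERIV_diff)
    show "(f \<alpha> t - g \<alpha> t)\<^sup>2 * \<bar>v \<alpha> t - w \<alpha> t\<bar> \<le> 2 * D"
    proof -
      have "(f \<alpha> t - g \<alpha> t)\<^sup>2 * \<bar>v \<alpha> t\<bar> \<le> D"
        unfolding D_def using order[OF tT, of \<alpha>] z
        by (intro velocity_bound[OF F(1)[OF t] F(2)[OF t] G(1)[OF t] G(2)[OF t]
            bound(1)[OF t] bound(2)[OF t] bound(3)[OF t] bound(4)[OF t] _ _ _ pv[OF t]]) auto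
      \<comment> \<open>The second equation is the first with the curves and the two weights
        exchanged.\<close>
      moreover have "(g \<alpha> t - f \<alpha> t)\<^sup>2 * \<bar>w \<alpha> t\<bar> \<le> D"
        unfolding D_def add.commute[of z1] using order[OF tT, of \<alpha>] z
        by (intro velocity_bound[OF G(1)[OF t] G(2)[OF t] F(1)[OF t] F(2)[OF t]
            bound(2)[OF t] bound(1)[OF t] bound(4)[OF t] bound(3)[OF t] _ _ _ pw[OF t]]) auto
      moreover have "(f \<alpha> t - g \<alpha> t)\<^sup>2 * \<bar>v \<alpha> t - w \<alpha> t\<bar>
        \<le> (f \<alpha> t - g \<alpha> t)\<^sup>2 * (\<bar>v \<alpha> t\<bar> + \<bar>w \<alpha> t\<bar>)"
        by (intro mult_left_mono) auto
      ultimately show ?thesis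
        by (simp add: power2_commute[of "g \<alpha> t"] distrib_left)
    qed
    assume \<alpha>: "f \<alpha> t - g \<alpha> t = S t"
    have "((\<lambda>x. f x t - g x t) has_real_derivative
        deriv (\<lambda>x. f x t) \<alpha> - deriv (\<lambda>x. g x t) \<alpha>) (at \<alpha>)"
      by (intro DERIV_diff F(1) G(1) t)
    then have "deriv (\<lambda>x. f x t) \<alpha> - deriv (\<lambda>x. g x t) \<alpha> = 0"
      by (rule DERIV_zero_at_minimum)
        (use min[OF tT] \<alpha> in \<open>simp add: is_minimum_of_def\<close>)
    then have slope: "deriv (\<lambda>x. f x t) \<alpha> = deriv (\<lambda>x. g x t) \<alpha>" by simp
    have cf: "continuous_on UNIV (\<lambda>x. f x t)" and cg: "continuous_on UNIV (\<lambda>x. g x t)"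
      using F(1)[OF t] G(1)[OF t]
      by (auto intro!: continuous_at_imp_continuous_on intro: DERIV_isCont)
    \<comment> \<open>The estimate is applied with the sup norms at time \<open>t\<close>, not with
      the uniform bounds on \<open>{0..b}\<close>, so that it yields the rate itself.\<close>
    have "\<bar>v \<alpha> t - w \<alpha> t\<bar> \<le> 8 * (z1 + z2)
        * (Linf_norm (\<lambda>x. f2 x t) + Linf_norm (\<lambda>x. g2 x t))
        * (Linf_norm (\<lambda>x. f x t) + Linf_norm (\<lambda>x. g x t) + 1) * (S t * (- ln (S t)))"
      by (rule relative_velocity_at_minimum[OF F(1)[OF t] F(2)[OF t] G(1)[OF t] G(2)[OF t]
            abs_le_Linf_norm[OF cf F(5)[OF t]] abs_le_Linf_norm[OF cg G(5)[OF t]]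
            abs_le_Linf_norm[OF F(4,6)[OF t]] abs_le_Linf_norm[OF G(4,6)[OF t]]
            \<alpha> S(1)[OF tT] S(2)[OF tT] slope z pv[OF t] pw[OF t]])
    also have "\<dots> = muskat_rate C f g t * (S t * (- ln (S t)))"
      by (simp add: muskat_rate_def C_def F(3)[OF t] G(3)[OF t])
    finally show "- (muskat_rate C f g t * (S t * (- ln (S t)))) \<le> v \<alpha> t - w \<alpha> t"
      by linarith
  next
    fix t assume "t \<in> {0..b}"
    then have t: "t \<in> {0..<T}" using sub by blast
    show "is_minimum_of (S t) (\<lambda>\<alpha>. f \<alpha> t - g \<alpha> t)" "0 < S t"
      using min[OF t] S(1)[OF t] .
    show "S t < 1" using S(2)[OF t] by (rule le_less_trans) simp
  qed (use b rate K in auto)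
  then show ?thesis by (simp only: C_def z1_def z2_def)
qed

theorem theorem1p1:
  shows "\<exists>c\<^sub>0::real. 0 < c\<^sub>0 \<and> c\<^sub>0 < 1 \<and>
    (\<forall>\<zeta>1 \<zeta>2 \<zeta>3 :: real. \<zeta>1 < \<zeta>2 \<longrightarrow> \<zeta>2 < \<zeta>3 \<longrightarrow>
      (\<exists>C::real. 0 < C \<and>
        (\<forall>(T::real) (f :: real \<Rightarrow> real \<Rightarrow> real) (g :: real \<Rightarrow> real \<Rightarrow> real)
            (f_inf::real) (g_inf::real) (S :: real \<Rightarrow> real).
          0 < T \<longrightarrow>
          smooth_free_boundary T f \<longrightarrow>
          smooth_free_boundary T g \<longrightarrow>
          (\<forall>\<alpha>. \<forall>t\<in>{0..<T}. f \<alpha> t > g \<alpha> t) \<longrightarrow>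
          muskat_solution \<zeta>1 \<zeta>2 \<zeta>3 T f g \<longrightarrow>
          (\<forall>t\<in>{0..<T}. ((\<lambda>\<alpha>. f \<alpha> t) \<longlongrightarrow> f_inf) at_top) \<longrightarrow>
          (\<forall>t\<in>{0..<T}. ((\<lambda>\<alpha>. g \<alpha> t) \<longlongrightarrow> g_inf) at_top) \<longrightarrow>
          f_inf > g_inf \<longrightarrow>
          (\<forall>t\<in>{0..<T}. is_minimum_of (S t) (\<lambda>\<alpha>. f \<alpha> t - g \<alpha> t)) \<longrightarrow>
          (\<forall>t\<in>{0..<T}. 0 < S t \<and> S t \<le> c\<^sub>0 * min (f_inf - g_inf) 1) \<longrightarrow>
          (\<forall>t\<in>{0..<T}.
            S t \<ge> exp (ln (S 0) * exp (set_lebesgue_integral lborel {0..t} (muskat_rate C f g)))))))"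
\<comment> \<open>The choice \<open>exp (- 1)\<close> gives \<open>S t \<le> exp (- 1)\<close>,
  hence \<open>- ln (S t) \<ge> 1\<close>, at all times.\<close>
proof (rule exI[of _ "exp (- 1)"], intro conjI allI impI, goal_cases)
  case (3 \<zeta>1 \<zeta>2 \<zeta>3)
  note \<zeta> = this
  define C where "C = 8 * ((\<zeta>2 - \<zeta>1) / (2 * pi) + (\<zeta>3 - \<zeta>2) / (2 * pi))"
  show ?case
  proof (rule exI[of _ C], intro conjI allI impI ballI)
    show "0 < C" using \<zeta> by (simp add: C_def add_pos_pos)
  next
    fix T f g f_inf g_inf S t
    assume *: "smooth_free_boundary T f" "smooth_free_boundary T g"
      "\<forall>\<alpha>. \<forall>t\<in>{0..<T}. g \<alpha> t < f \<alpha> t"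
      "muskat_solution \<zeta>1 \<zeta>2 \<zeta>3 T f g"
      "\<forall>t\<in>{0..<T}. is_minimum_of (S t) (\<lambda>\<alpha>. f \<alpha> t - g \<alpha> t)"
      "\<forall>t\<in>{0..<T}. 0 < S t \<and> S t \<le> exp (- 1) * min (f_inf - g_inf) 1"
      "t \<in> {0..<T}"
    have "S s \<le> exp (- 1)" if "s \<in> {0..<T}" for s
    proof -
      have "S s \<le> exp (- 1) * min (f_inf - g_inf) 1" using *(6) that by blast
      also have "\<dots> \<le> exp (- 1) * 1" by (intro mult_left_mono) auto
      finally show ?thesis by simp
    qed
    then show "exp (ln (S 0) * exp (set_lebesgue_integral lborel {0..t} (muskat_rate C f g))) \<le> S t"
      unfolding C_def using * \<zeta> by (intro muskat_minimum_lower_bound) auto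
  qed
qed auto

end
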